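(* Let $\mathbb{K}$ be an algebraically closed field and let $q\in\mathbb{K}$ be nonzero and not a root of $1$. Let $V$ denote a NonNil finite-dimensional irreducible $\mathcal{A}_q$-module of type $(1,1)$. Then there exists a unique $\boxtimes_q$-module structure on $V$ such that the standard generators $x$ and $y$ of $\mathcal{A}_q$ act on $V$ as $x_{01}$ and $x_{23}$ respectively. This $\boxtimes_q$-module structure is irreducible and of type $1$.
   Context: Let $[n]_q=\frac{q^n-q^{-n}}{q-q^{-1}}$ and $\mathbb{Z}_4=\mathbb{Z}/4\mathbb{Z}$. The $q$-tetrahedron algebra $\boxtimes_q$ is the unital associative $\mathbb{K}$-algebra with generators $\{x_{ij}\mid i,j\in\mathbb{Z}_4,\ j-i=1\text{ or }j-i=2\}$ and relations: (i) for $i,j\in\mathbb{Z}_4$ with $j-i=2$, $x_{ij}x_{ji}=1$; (ii) for $h,i,j\in\mathbb{Z}_4$ such that $(i-h,j-i)$ is one of $(1,1),(1,2),(2,1)$, $\frac{q x_{hi}x_{ij}-q^{-1}x_{ij}x_{hi}}{q-q^{-1}}=1$; (iii) for $h,i,j,k\in\mathbb{Z}_4$ with $i-h=j-i=k-j=1$, $x_{hi}^3x_{jk}-[3]_q x_{hi}^2x_{jk}x_{hi}+[3]_q x_{hi}x_{jk}x_{hi}^2-x_{jk}x_{hi}^3=0$. $\mathcal{A}_q$ is the unital associative $\mathbb{K}$-algebra with generators $x,y$ (the standard generators) and relations $x^3y-[3]_q x^2yx+[3]_q xyx^2-yx^3=0$ and $y^3x-[3]_q y^2xy+[3]_q yxy^2-xy^3=0$.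 Irreducible modules are nonzero. For every finite-dimensional irreducible $\boxtimes_q$-module $V$ there exist an integer $d\ge 0$ (the diameter) and a scalar $\varepsilon\in\{1,-1\}$ (the type of $V$) such that every generator $x_{ij}$ acts semisimply (diagonalizably) on $V$ with set of distinct eigenvalues $\{\varepsilon q^{d-2n}\mid 0\le n\le d\}$. A finite-dimensional $\mathcal{A}_q$-module $V$ is NonNil if neither $x$ nor $y$ acts nilpotently on $V$. For a NonNil finite-dimensional irreducible $\mathcal{A}_q$-module $V$ it is known that $x,y$ are semisimple on $V$ and there exist an integer $d\ge0$ and nonzero $\alpha,\alpha^*\in\mathbb{K}$ such that the set of distinct eigenvalues of $x$ (resp. $y$) on $V$ is $\{\alpha q^{d-2n}\mid 0\le n\le d\}$ (resp. $\{\alpha^* q^{d-2n}\mid 0\le n\le d\}$); the pair $(\alpha,\alpha^* )$ is called the type of $V$. *)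

theory Defs
  imports
    "HOL-Computational_Algebra.Polynomial"
    "HOL-Library.Poly_Mapping"
    "HOL-Library.Numeral_Type"
    "HOL-Algebra.QuotRing"
    "HOL-Algebra.Module"
begin

section \<open>Algebras given by generators and relations\<close>

text \<open>
  The free monoid is wrapped in its own type in order to obtain a \<^class>\<open>monoid_add\<close> instance
  (addition is concatenation) without instantiating \<^typ>\<open>'g list\<close>.
  The type \<open>'g word \<Rightarrow>\<^sub>0 'k\<close> of finitely supported functions, with the convolution product of
  \<open>Poly_Mapping\<close>, is then the free unital associative algebra on all of \<open>'g\<close>.
\<close>

datatype 'g word = Word (letters: "'g list")

instantiation word :: (type) monoid_add
begin

definition zero_word :: "'g word" where
  "zero_word = Word []"

definition plus_word :: "'g word \<Rightarrow> 'g word \<Rightarrow> 'g word" where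
  "plus_word u v = Word (letters u @ letters v)"

instance
  by intro_classes (simp_all add: zero_word_def plus_word_def)

end

type_synonym ('g, 'k) ncpoly = "'g word \<Rightarrow>\<^sub>0 'k"

definition const :: "'k::field \<Rightarrow> ('g, 'k) ncpoly" where
  "const c = Poly_Mapping.single 0 c"

definition letter :: "'g \<Rightarrow> ('g, 'k::field) ncpoly" where
  "letter g = Poly_Mapping.single (Word [g]) 1"

text \<open>
  A \<open>'k\<close>-algebra is represented by a record of type \<open>('k, 'a) module\<close>, that is, a ring together
  with a scalar multiplication by elements of the type \<open>'k\<close>.
\<close>

definition free_algebra :: "'g set \<Rightarrow> ('k::field, ('g, 'k) ncpoly) module" where
  "free_algebra X =
    \<lparr>carrier = {p. \<forall>w\<in>Poly_Mapping.keys p. set (letters w) \<subseteq> X},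
     monoid.mult = (*), one = 1, zero = 0, add = (+),
     module.smult = (\<lambda>c p. const c * p)\<rparr>"

definition quotient_algebra :: "('k, 'a) module \<Rightarrow> 'a set \<Rightarrow> ('k, 'a set) module" where
  "quotient_algebra F I =
    \<lparr>carrier = carrier (F Quot I),
     monoid.mult = monoid.mult (F Quot I), one = one (F Quot I),
     zero = zero (F Quot I), add = add (F Quot I),
     module.smult = (\<lambda>c a. (I +>\<^bsub>F\<^esub> (c \<odot>\<^bsub>F\<^esub> \<one>\<^bsub>F\<^esub>)) \<otimes>\<^bsub>F Quot I\<^esub> a)\<rparr>"

text \<open>
  A relation \<open>lhs = rhs\<close> is given by the relator \<open>lhs - rhs\<close>.  Note that \<^const>\<open>genideal\<close>
  generates a two-sided ideal.
\<close>

definition presented_algebra ::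
    "'g set \<Rightarrow> ('g, 'k::field) ncpoly set \<Rightarrow> ('k, ('g, 'k) ncpoly set) module" where
  "presented_algebra X R =
    quotient_algebra (free_algebra X) (Idl\<^bsub>free_algebra X\<^esub> R)"

definition presented_generator ::
    "'g set \<Rightarrow> ('g, 'k::field) ncpoly set \<Rightarrow> 'g \<Rightarrow> ('g, 'k) ncpoly set" where
  "presented_generator X R g = (Idl\<^bsub>free_algebra X\<^esub> R) +>\<^bsub>free_algebra X\<^esub> letter g"

lemma ring_free_algebra: "ring (free_algebra X :: ('k::field, ('g, 'k) ncpoly) module)"
  (is "ring ?F")
proof (rule ringI)
  show "abelian_group ?F"
  proof (rule abelian_groupI)
    fix p assume "p \<in> carrier ?F"
    then show "\<exists>r\<in>carrier ?F. r \<oplus>\<^bsub>?F\<^esub> p = \<zero>\<^bsub>?F\<^esub>"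
      by (intro bexI[of _ "- p"]) (auto simp: free_algebra_def)
  next
    fix p r assume "p \<in> carrier ?F" "r \<in> carrier ?F"
    then show "p \<oplus>\<^bsub>?F\<^esub> r \<in> carrier ?F"
      using Poly_Mapping.keys_add[of p r] by (fastforce simp: free_algebra_def)
  qed (auto simp: free_algebra_def algebra_simps)
next
  show "Group.monoid ?F"
  proof (rule Group.monoidI)
    fix p r assume "p \<in> carrier ?F" "r \<in> carrier ?F"
    then show "p \<otimes>\<^bsub>?F\<^esub> r \<in> carrier ?F"
      using keys_mult[of p r] by (fastforce simp: free_algebra_def plus_word_def)
  qed (auto simp: free_algebra_def algebra_simps zero_word_def)
qed (auto simp: free_algebra_def algebra_simps)


section \<open>Modules over a \<open>'k\<close>-algebra\<close>

definition finite_dimensional :: "('k::field \<Rightarrow> 'v::ab_group_add \<Rightarrow> 'v) \<Rightarrow> bool" where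
  "finite_dimensional scale \<longleftrightarrow> (\<exists>B. finite B \<and> Modules.module.span scale B = UNIV)"

definition End_algebra ::
    "('k::field \<Rightarrow> 'v::ab_group_add \<Rightarrow> 'v) \<Rightarrow> ('k, 'v \<Rightarrow> 'v) module" where
  "End_algebra scale =
    \<lparr>carrier = {f. Vector_Spaces.linear scale scale f},
     monoid.mult = (\<circ>), one = id, zero = (\<lambda>v. 0), add = (\<lambda>f g v. f v + g v),
     module.smult = (\<lambda>c f v. scale c (f v))\<rparr>"

definition algebra_hom :: "('k, 'a) module \<Rightarrow> ('k, 'b) module \<Rightarrow> ('a \<Rightarrow> 'b) set" where
  "algebra_hom A B =
    {h \<in> ring_hom A B. \<forall>c. \<forall>a\<in>carrier A. h (c \<odot>\<^bsub>A\<^esub> a) = c \<odot>\<^bsub>B\<^esub> h a}"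

text \<open>
  An \<open>A\<close>-module structure on the vector space \<open>(UNIV, scale)\<close>.  The action is required to be
  extensional, i.e. it has a fixed dummy value outside the carrier of \<open>A\<close>, so that equality of
  actions as HOL functions is equality of module structures.
\<close>

definition module_structures ::
    "('k::field, 'a) module \<Rightarrow> ('k \<Rightarrow> 'v::ab_group_add \<Rightarrow> 'v) \<Rightarrow> ('a \<Rightarrow> 'v \<Rightarrow> 'v) set" where
  "module_structures A scale =
    algebra_hom A (End_algebra scale) \<inter> extensional (carrier A)"

definition irreducible_module ::
    "('k::field, 'a) module \<Rightarrow> ('k \<Rightarrow> 'v::ab_group_add \<Rightarrow> 'v) \<Rightarrow> ('a \<Rightarrow> 'v \<Rightarrow> 'v) \<Rightarrow> bool" where
  "irreducible_module A scale \<rho> \<longleftrightarrow>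
    (\<exists>v::'v. v \<noteq> 0) \<and>
    (\<forall>W. Modules.module.subspace scale W \<and> (\<forall>a\<in>carrier A. \<forall>w\<in>W. \<rho> a w \<in> W)
      \<longrightarrow> W = {0} \<or> W = UNIV)"

definition nilpotent_map :: "('v::zero \<Rightarrow> 'v) \<Rightarrow> bool" where
  "nilpotent_map f \<longleftrightarrow> (\<exists>n. \<forall>v. (f ^^ n) v = 0)"

definition eigenvalues :: "('k \<Rightarrow> 'v::zero \<Rightarrow> 'v) \<Rightarrow> ('v \<Rightarrow> 'v) \<Rightarrow> 'k set" where
  "eigenvalues scale f = {\<theta>. \<exists>v. v \<noteq> 0 \<and> f v = scale \<theta> v}"

definition diagonalizable :: "('k::field \<Rightarrow> 'v::ab_group_add \<Rightarrow> 'v) \<Rightarrow> ('v \<Rightarrow> 'v) \<Rightarrow> bool" where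
  "diagonalizable scale f \<longleftrightarrow>
    (\<exists>B. \<not> Modules.module.dependent scale B \<and> Modules.module.span scale B = UNIV \<and>
         (\<forall>b\<in>B. \<exists>\<theta>. f b = scale \<theta> b))"


section \<open>The \<open>q\<close>-tetrahedron algebra and the algebra \<open>\<A>\<^sub>q\<close>\<close>

definition q_int :: "'k::field \<Rightarrow> int \<Rightarrow> 'k" where
  "q_int q n = (q powi n - q powi (- n)) / (q - inverse q)"

definition tet_generators :: "(4 \<times> 4) set" where
  "tet_generators = {(i, j). j - i = 1 \<or> j - i = 2}"

text \<open>The type \<^typ>\<open>4\<close> is the ring of integers modulo 4.\<close>

definition tet_relators :: "'k::field \<Rightarrow> (4 \<times> 4, 'k) ncpoly set" where
  "tet_relators q =
    (let x = (\<lambda>i j. letter (i, j)) in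
      {x i j * x j i - 1 | i j. j - i = 2} \<union>
      {const (1 / (q - inverse q))
          * (const q * x h i * x i j - const (inverse q) * x i j * x h i) - 1
        | h i j. (i - h, j - i) \<in> {(1, 1), (1, 2), (2, 1)}} \<union>
      {x h i ^ 3 * x j k - const (q_int q 3) * x h i ^ 2 * x j k * x h i
          + const (q_int q 3) * x h i * x j k * x h i ^ 2 - x j k * x h i ^ 3
        | h i j k. i - h = 1 \<and> j - i = 1 \<and> k - j = 1})"

definition tet_algebra :: "'k::field \<Rightarrow> ('k, (4 \<times> 4, 'k) ncpoly set) module" where
  "tet_algebra q = presented_algebra tet_generators (tet_relators q)"

definition tet_gen :: "'k::field \<Rightarrow> 4 \<Rightarrow> 4 \<Rightarrow> (4 \<times> 4, 'k) ncpoly set" where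
  "tet_gen q i j = presented_generator tet_generators (tet_relators q) (i, j)"

datatype aq_letter = LetterX | LetterY

definition aq_relators :: "'k::field \<Rightarrow> (aq_letter, 'k) ncpoly set" where
  "aq_relators q =
    (let x = letter LetterX; y = letter LetterY; b = const (q_int q 3) in
      {x ^ 3 * y - b * x ^ 2 * y * x + b * x * y * x ^ 2 - y * x ^ 3,
       y ^ 3 * x - b * y ^ 2 * x * y + b * y * x * y ^ 2 - x * y ^ 3})"

definition aq_algebra :: "'k::field \<Rightarrow> ('k, (aq_letter, 'k) ncpoly set) module" where
  "aq_algebra q = presented_algebra UNIV (aq_relators q)"

definition aq_x :: "'k::field \<Rightarrow> (aq_letter, 'k) ncpoly set" where
  "aq_x q = presented_generator UNIV (aq_relators q) LetterX"

definition aq_y :: "'k::field \<Rightarrow> (aq_letter, 'k) ncpoly set" where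
  "aq_y q = presented_generator UNIV (aq_relators q) LetterY"

definition NonNil ::
    "'k::field \<Rightarrow> ((aq_letter, 'k) ncpoly set \<Rightarrow> 'v::ab_group_add \<Rightarrow> 'v) \<Rightarrow> bool" where
  "NonNil q \<rho> \<longleftrightarrow> \<not> nilpotent_map (\<rho> (aq_x q)) \<and> \<not> nilpotent_map (\<rho> (aq_y q))"

definition aq_type ::
    "'k::field \<Rightarrow> ('k \<Rightarrow> 'v::ab_group_add \<Rightarrow> 'v) \<Rightarrow> ((aq_letter, 'k) ncpoly set \<Rightarrow> 'v \<Rightarrow> 'v)
      \<Rightarrow> 'k \<Rightarrow> 'k \<Rightarrow> bool" where
  "aq_type q scale \<rho> \<alpha> \<alpha>' \<longleftrightarrow> \<alpha> \<noteq> 0 \<and> \<alpha>' \<noteq> 0 \<and>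
    (\<exists>d::nat.
      eigenvalues scale (\<rho> (aq_x q)) = {\<alpha> * q powi (int d - 2 * int n) | n. n \<le> d} \<and>
      eigenvalues scale (\<rho> (aq_y q)) = {\<alpha>' * q powi (int d - 2 * int n) | n. n \<le> d})"

text \<open>The existentially quantified \<open>d\<close> is the diameter; it is common to all generators.\<close>

definition tet_type ::
    "'k::field \<Rightarrow> ('k \<Rightarrow> 'v::ab_group_add \<Rightarrow> 'v) \<Rightarrow> ((4 \<times> 4, 'k) ncpoly set \<Rightarrow> 'v \<Rightarrow> 'v)
      \<Rightarrow> 'k \<Rightarrow> bool" where
  "tet_type q scale \<sigma> \<epsilon> \<longleftrightarrow> \<epsilon> \<in> {1, - 1} \<and>
    (\<exists>d::nat. \<forall>(i, j)\<in>tet_generators.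
      diagonalizable scale (\<sigma> (tet_gen q i j)) \<and>
      eigenvalues scale (\<sigma> (tet_gen q i j)) = {\<epsilon> * q powi (int d - 2 * int n) | n. n \<le> d})"

end

theory Submission
  imports Defs
begin

text \<open>
  Let \<open>A\<close> and \<open>B\<close> be the operators by which \<open>x\<close> and \<open>y\<close> act.  On an eigenvector of \<open>A\<close> for the
  eigenvalue \<open>t\<close>, the cubic relation says that \<open>(A - q\<^sup>2 t) (A - t) (A - q\<^sup>-\<^sup>2 t) B\<close> vanishes, so \<open>B\<close> moves
  it into the sum of the eigenspaces for \<open>q\<^sup>2 t\<close>, \<open>t\<close>, \<open>q\<^sup>-\<^sup>2 t\<close>.  Hence the sum of all eigenspaces of \<open>A\<close> is a
  submodule and \<open>A\<close> is diagonalizable; in the same way \<open>B\<close> is.  Adding up the eigenspaces of \<open>A\<close>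
  in the order of the eigenvalues \<open>q\<^sup>d, q\<^sup>d\<^sup>-\<^sup>2, \<dots>, q\<^sup>-\<^sup>d\<close>, or in the reverse order, gives two flags
  \<open>E 0\<close> and \<open>E 1\<close>, and \<open>B\<close> gives \<open>E 2\<close> and \<open>E 3\<close> likewise.  Here a flag is a filtration
  \<open>0 \<subseteq> F 0 \<subseteq> \<dots> \<subseteq> F d = V\<close>.

  The point is that any two of the four flags are opposite: \<open>V\<close> is the direct sum of the spaces
  \<open>E i n \<inter> E j (d - n)\<close>.  For one flag of \<open>A\<close> and one of \<open>B\<close> this is the split decomposition of Ito,
  Tanabe and Terwilliger (\<open>opposite_of_irreducible\<close>): the sums of the \<open>E i n \<inter> E j (s - n)\<close> over \<open>n\<close>
  are submodules, hence \<open>0\<close> or \<open>V\<close>.  Consequently there is exactly one operator \<open>X i j\<close> that acts as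
  \<open>q\<^sup>d\<^sup>-\<^sup>2\<^sup>n\<close> on \<open>E i n / E i (n - 1)\<close> and as \<open>q\<^sup>2\<^sup>n\<^sup>-\<^sup>d\<close> on \<open>E j n / E j (n - 1)\<close>, for each \<open>n\<close>
  (\<open>edge_exists\<close>, \<open>edge_unique\<close>).  By construction \<open>X 0 1 = A\<close> and \<open>X 2 3 = B\<close>.

  These operators satisfy the relations.  Clearly \<open>X i j\<close> is inverse to \<open>X j i\<close>.  For distinct \<open>h, i, j\<close>,
  the \<open>q\<close>-Weyl relation between \<open>X h i\<close> and \<open>X i j\<close> follows as soon as \<open>X h i\<close> maps every \<open>E j n\<close> into
  \<open>E j (n + 1)\<close>, and it implies that \<open>X i j\<close> maps every \<open>E h n\<close> into \<open>E h (n + 1)\<close> (\<open>triangle\<close>,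
  \<open>triangle_raises\<close>).  So a single such inclusion travels around the whole triangle \<open>h, i, j\<close>.  Every
  triangle with vertices in \<open>{0, 1, 2, 3}\<close> has \<open>{0, 1}\<close> or \<open>{2, 3}\<close> as a side, and on that side the
  inclusion is the tridiagonal action of \<open>A\<close> or of \<open>B\<close>.  The cubic relation between two opposite sides
  of the tetrahedron follows from the inclusions too (\<open>q_serre_of_raises\<close>), by reversing the argument
  of the first paragraph.

  Conversely, a \<open>q\<close>-Weyl relation with an operator \<open>X i j\<close> that is already known forces the action of the
  other operator on the quotients of a flag (\<open>q_weyl_acts\<close>, \<open>q_weyl_acts_left\<close>).  For each generator
  two of the relations prescribe its action on both of its flags, hence the generator itself.  This
  gives uniqueness and at the same time the eigenvalues, and irreducibility is inherited from \<open>A\<close>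
  and \<open>B\<close>.
\<close>

section \<open>Evaluation of noncommutative polynomials\<close>

definition word_action :: "('g \<Rightarrow> 'v \<Rightarrow> 'v) \<Rightarrow> 'g word \<Rightarrow> 'v \<Rightarrow> 'v" where
  "word_action g w = foldr (\<lambda>x f. g x \<circ> f) (letters w) id"

lemma word_action_0 [simp]: "word_action g 0 = id"
  by (simp add: word_action_def zero_word_def)

lemma word_action_Word [simp]: "word_action g (Word []) = id" "word_action g (Word (x # xs)) = g x \<circ> word_action g (Word xs)"
  by (simp_all add: word_action_def)

lemma word_action_plus [simp]: "word_action g (u + w) = word_action g u \<circ> word_action g w"
proof -
  have "foldr (\<lambda>x f. g x \<circ> f) (xs @ ys) id
      = foldr (\<lambda>x f. g x \<circ> f) xs id \<circ> foldr (\<lambda>x f. g x \<circ> f) ys id" for xs ys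
    by (induction xs) (simp_all add: comp_assoc)
  then show ?thesis by (simp add: word_action_def plus_word_def)
qed

definition evaluate ::
    "('k::field \<Rightarrow> 'v::ab_group_add \<Rightarrow> 'v) \<Rightarrow> ('g \<Rightarrow> 'v \<Rightarrow> 'v) \<Rightarrow> ('g, 'k) ncpoly \<Rightarrow> 'v \<Rightarrow> 'v" where
  "evaluate scale g p v =
    (\<Sum>w\<in>Poly_Mapping.keys p. scale (Poly_Mapping.lookup p w) (word_action g w v))"

text \<open>
  Induction over the monomials of a polynomial, restricted to a set \<open>S\<close> of words so that it can be
  used inside the free algebra on a subset of the letters.
\<close>

lemma ncpoly_induct [case_names zero monomial]:
  assumes "P 0"
    and "\<And>p w c. P p \<Longrightarrow> w \<in> S \<Longrightarrow> P (p + Poly_Mapping.single w c)"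
    and "Poly_Mapping.keys p \<subseteq> S"
  shows "P (p :: ('g, 'k::field) ncpoly)"
proof -
  let ?s = "\<lambda>A. \<Sum>w\<in>A. Poly_Mapping.single w (Poly_Mapping.lookup p w)"
  have "P (?s A)" if "finite A" "A \<subseteq> S" for A
    using that
  proof (induction A rule: finite_induct)
    case empty
    then show ?case using assms(1) by simp
  next
    case (insert w A)
    then show ?case using assms(2)[of "?s A" w] by (simp add: add.commute)
  qed
  moreover have "?s (Poly_Mapping.keys p) = p"
  proof (rule poly_mapping_eqI)
    fix u
    have "Poly_Mapping.lookup (?s (Poly_Mapping.keys p)) u
        = (\<Sum>w\<in>Poly_Mapping.keys p. if w = u then Poly_Mapping.lookup p w else 0)"
      by (simp add: lookup_sum lookup_single when_def)
    also have "\<dots> = Poly_Mapping.lookup p u"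
      by (simp add: sum.delta in_keys_iff)
    finally show "Poly_Mapping.lookup (?s (Poly_Mapping.keys p)) u = Poly_Mapping.lookup p u" .
  qed
  ultimately show ?thesis using assms(3) by (metis finite_keys)
qed

locale operators = vector_space scale
  for scale :: "'k::field \<Rightarrow> 'v::ab_group_add \<Rightarrow> 'v"
begin

abbreviation lin :: "('v \<Rightarrow> 'v) \<Rightarrow> bool" where
  "lin f \<equiv> Vector_Spaces.linear scale scale f"

lemma lin_iff:
  "lin f \<longleftrightarrow> (\<forall>u v. f (u + v) = f u + f v) \<and> (\<forall>c v. f (scale c v) = scale c (f v))"
  using vector_space_axioms by (auto simp: Vector_Spaces.linear_iff)

lemma lin_add: "lin f \<Longrightarrow> f (u + v) = f u + f v"
  and lin_scale: "lin f \<Longrightarrow> f (scale c v) = scale c (f v)"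
  by (simp_all add: lin_iff)

lemma lin_0: "lin f \<Longrightarrow> f 0 = 0"
  using lin_scale[of f 0 0] by simp

lemma lin_diff: "lin f \<Longrightarrow> f (u - v) = f u - f v"
  using lin_add[of f "u - v" v] by simp

lemma lin_sum: "lin f \<Longrightarrow> f (\<Sum>i\<in>S. h i) = (\<Sum>i\<in>S. f (h i))"
  by (induction S rule: infinite_finite_induct) (simp_all add: lin_0 lin_add)

lemma lin_word_action:
  assumes "\<And>x. lin (g x)"
  shows "lin (word_action g w)"
proof -
  have "lin (word_action g (Word xs))" for xs
    using assms by (induction xs) (simp_all add: lin_iff)
  then show ?thesis by (metis word.collapse)
qed

lemma evaluate_superset:
  assumes "finite S" "Poly_Mapping.keys p \<subseteq> S"
  shows "evaluate scale g p v = (\<Sum>w\<in>S. scale (Poly_Mapping.lookup p w) (word_action g w v))"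
  unfolding evaluate_def
  by (rule sum.mono_neutral_left) (use assms in \<open>auto simp: in_keys_iff\<close>)

lemma evaluate_0: "evaluate scale g 0 v = 0"
  by (simp add: evaluate_def)

lemma evaluate_add: "evaluate scale g (p + r) v = evaluate scale g p v + evaluate scale g r v"
proof -
  let ?S = "Poly_Mapping.keys p \<union> Poly_Mapping.keys r"
  have "evaluate scale g s v = (\<Sum>w\<in>?S. scale (Poly_Mapping.lookup s w) (word_action g w v))"
    if "s \<in> {p, r, p + r}" for s
    using that Poly_Mapping.keys_add[of p r] by (intro evaluate_superset) auto
  then show ?thesis
    by (simp add: lookup_add scale_left_distrib sum.distrib)
qed

lemma evaluate_single: "evaluate scale g (Poly_Mapping.single w c) v = scale c (word_action g w v)"
  by (simp add: evaluate_def)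

lemma lin_evaluate:
  assumes "\<And>x. lin (g x)"
  shows "lin (evaluate scale g p)"
  using lin_word_action[of g, OF assms]
  by (auto simp: lin_iff evaluate_def scale_right_distrib sum.distrib scale_sum_right ac_simps)

text \<open>
  The product of polynomials is a convolution over words; since both sides are additive in each
  factor, it suffices to compare them on monomials.
\<close>

lemma evaluate_mult:
  assumes lin: "\<And>x. lin (g x)"
  shows "evaluate scale g (p * r) v = evaluate scale g p (evaluate scale g r v)"
proof (induction p rule: ncpoly_induct[where S = UNIV])
  case zero
  then show ?case by (simp add: evaluate_0)
next
  case (monomial p u c)
  have "evaluate scale g (Poly_Mapping.single u c * r) v = scale c (word_action g u (evaluate scale g r v))"
  proof (induction r rule: ncpoly_induct[where S = UNIV])
    case zero
    then show ?case by (simp add: evaluate_0 lin_0[OF lin_word_action[OF lin]])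
  next
    case (monomial r w b)
    then show ?case
      by (simp add: distrib_left evaluate_add evaluate_single mult_single scale_right_distrib
          lin_add[OF lin_word_action[OF lin]] lin_scale[OF lin_word_action[OF lin]])
  qed simp
  with monomial show ?case
    by (simp add: distrib_right evaluate_add evaluate_single)
qed simp

lemma evaluate_uminus: "evaluate scale g (- p) v = - evaluate scale g p v"
  using evaluate_add[of g p "- p" v] by (simp add: evaluate_0 minus_unique)

lemma evaluate_diff: "evaluate scale g (p - r) v = evaluate scale g p v - evaluate scale g r v"
  using evaluate_add[of g p "- r" v] by (simp add: evaluate_uminus)

lemma evaluate_const: "evaluate scale g (const c) v = scale c v"
  by (simp add: const_def evaluate_single)

lemma evaluate_1: "evaluate scale g 1 v = v"
  using evaluate_const[of g 1 v] by (simp add: const_def)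

lemma evaluate_letter: "evaluate scale g (letter x) v = g x v"
  by (simp add: letter_def evaluate_single)

lemma evaluate_power:
  assumes "\<And>x. lin (g x)"
  shows "evaluate scale g (p ^ n) v = (evaluate scale g p ^^ n) v"
  by (induction n arbitrary: v) (simp_all add: evaluate_1 evaluate_mult[OF assms])

lemmas evaluate_simps =
  evaluate_add evaluate_diff evaluate_mult evaluate_const evaluate_1 evaluate_letter evaluate_power

end

section \<open>Modules over algebras given by generators and relations\<close>

lemma free_algebra_closed:
  fixes p r :: "('g, 'k::field) ncpoly"
  shows "p \<in> carrier (free_algebra X) \<Longrightarrow> r \<in> carrier (free_algebra X) \<Longrightarrow> p * r \<in> carrier (free_algebra X)"
    and "p \<in> carrier (free_algebra X) \<Longrightarrow> r \<in> carrier (free_algebra X) \<Longrightarrow> p + r \<in> carrier (free_algebra X)"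
    and "p \<in> carrier (free_algebra X) \<Longrightarrow> r \<in> carrier (free_algebra X) \<Longrightarrow> p - r \<in> carrier (free_algebra X)"
    and "p \<in> carrier (free_algebra X) \<Longrightarrow> p ^ n \<in> carrier (free_algebra X)"
    and "1 \<in> carrier (free_algebra X :: ('k, ('g, 'k) ncpoly) module)"
    and "const c \<in> carrier (free_algebra X :: ('k, ('g, 'k) ncpoly) module)"
    and "x \<in> X \<Longrightarrow> letter x \<in> carrier (free_algebra X :: ('k, ('g, 'k) ncpoly) module)"
proof -
  let ?F = "free_algebra X :: ('k, ('g, 'k) ncpoly) module"
  interpret ring ?F by (rule ring_free_algebra)
  have ops: "p \<otimes>\<^bsub>?F\<^esub> r = p * r" "p \<oplus>\<^bsub>?F\<^esub> r = p + r" "\<one>\<^bsub>?F\<^esub> = 1" for p r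
    by (simp_all add: free_algebra_def)
  show mult: "p \<in> carrier ?F \<Longrightarrow> r \<in> carrier ?F \<Longrightarrow> p * r \<in> carrier ?F" for p r
    using m_closed[of p r] by (simp add: ops)
  show add: "p \<in> carrier ?F \<Longrightarrow> r \<in> carrier ?F \<Longrightarrow> p + r \<in> carrier ?F" for p r
    using a_closed[of p r] by (simp add: ops)
  show "p \<in> carrier ?F \<Longrightarrow> r \<in> carrier ?F \<Longrightarrow> p - r \<in> carrier ?F"
    using add[of p "- r"] by (simp add: free_algebra_def)
  show one: "1 \<in> carrier ?F"
    using one_closed by (simp add: ops)
  show "p \<in> carrier ?F \<Longrightarrow> p ^ n \<in> carrier ?F"
    by (induction n) (simp_all add: one mult)
  show "const c \<in> carrier ?F"
    by (simp add: free_algebra_def const_def zero_word_def)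
  show "x \<in> X \<Longrightarrow> letter x \<in> carrier ?F"
    by (simp add: free_algebra_def letter_def)
qed

lemmas const_closed [simp] = free_algebra_closed(6)
  and letter_closed [simp] = free_algebra_closed(7)

locale presentation = operators scale
  for scale :: "'k::field \<Rightarrow> 'v::ab_group_add \<Rightarrow> 'v" +
  fixes X :: "'g set" and R :: "('g, 'k) ncpoly set"
  assumes relators_closed: "R \<subseteq> carrier (free_algebra X)"
begin

abbreviation F where "F \<equiv> (free_algebra X :: ('k, ('g, 'k) ncpoly) module)"
abbreviation I where "I \<equiv> Idl\<^bsub>F\<^esub> R"
abbreviation P where "P \<equiv> presented_algebra X R"

sublocale F: ring F by (rule ring_free_algebra)

sublocale I: ideal I F by (rule F.genideal_ideal[OF relators_closed])

lemma free_simps [simp]: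
  "p \<otimes>\<^bsub>F\<^esub> r = p * r" "p \<oplus>\<^bsub>F\<^esub> r = p + r" "\<one>\<^bsub>F\<^esub> = 1" "\<zero>\<^bsub>F\<^esub> = 0" "c \<odot>\<^bsub>F\<^esub> p = const c * p"
  by (simp_all add: free_algebra_def)

lemma carrier_free: "carrier F = {p. \<forall>w\<in>Poly_Mapping.keys p. set (letters w) \<subseteq> X}"
  by (simp add: free_algebra_def)

lemma carrier_presented: "carrier P = (\<lambda>p. I +>\<^bsub>F\<^esub> p) ` carrier F"
  by (auto simp: presented_algebra_def quotient_algebra_def FactRing_def A_RCOSETS_def')

lemma presented_mult:
  "p \<in> carrier F \<Longrightarrow> r \<in> carrier F \<Longrightarrow>
    (I +>\<^bsub>F\<^esub> p) \<otimes>\<^bsub>P\<^esub> (I +>\<^bsub>F\<^esub> r) = I +>\<^bsub>F\<^esub> (p * r)"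
  using I.rcoset_mult_add[of p r]
  by (simp add: presented_algebra_def quotient_algebra_def FactRing_def)

lemma presented_add:
  "p \<in> carrier F \<Longrightarrow> r \<in> carrier F \<Longrightarrow>
    (I +>\<^bsub>F\<^esub> p) \<oplus>\<^bsub>P\<^esub> (I +>\<^bsub>F\<^esub> r) = I +>\<^bsub>F\<^esub> (p + r)"
  using I.a_rcos_sum[of p r]
  by (simp add: presented_algebra_def quotient_algebra_def FactRing_def)

lemma presented_smult:
  "p \<in> carrier F \<Longrightarrow> c \<odot>\<^bsub>P\<^esub> (I +>\<^bsub>F\<^esub> p) = I +>\<^bsub>F\<^esub> (const c * p)"
  using I.rcoset_mult_add[of "const c" p]
  by (simp add: presented_algebra_def quotient_algebra_def FactRing_def)

lemma presented_one: "\<one>\<^bsub>P\<^esub> = I +>\<^bsub>F\<^esub> 1"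
  by (simp add: presented_algebra_def quotient_algebra_def FactRing_def)

lemmas presented_ops = presented_mult presented_add presented_smult presented_one

lemma coset_eq_iff:
  assumes "p \<in> carrier F" "r \<in> carrier F"
  shows "I +>\<^bsub>F\<^esub> p = I +>\<^bsub>F\<^esub> r \<longleftrightarrow> p - r \<in> I"
proof -
  have "\<ominus>\<^bsub>F\<^esub> r = - r"
    using assms F.minus_equality[of "- r" r] by (simp add: carrier_free)
  then have "p \<ominus>\<^bsub>F\<^esub> r = p - r"
    by (simp add: a_minus_def)
  then show ?thesis
    using F.quotient_eq_iff_same_a_r_cos[OF I.is_ideal assms] by simp
qed

lemma carrier_End: "carrier (End_algebra scale) = Collect lin"
  by (simp add: End_algebra_def)

abbreviation gen where "gen \<equiv> presented_generator X R"

lemma gen_closed: "x \<in> X \<Longrightarrow> gen x \<in> carrier P"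
  by (auto simp: carrier_presented presented_generator_def)

text \<open>
  Polynomials have letters from the whole type, but only the letters in \<open>X\<close> have an image in the
  algebra; the others are sent to \<open>0\<close> so that \<^const>\<open>evaluate\<close> applies.
\<close>

definition images where
  "images \<sigma> x = (if x \<in> X then \<sigma> (gen x) else (\<lambda>v. 0))"

lemma module_structure_lin:
  assumes "\<sigma> \<in> module_structures P scale" "a \<in> carrier P"
  shows "lin (\<sigma> a)"
  using assms ring_hom_closed[of \<sigma> P "End_algebra scale" a]
  by (simp add: module_structures_def algebra_hom_def carrier_End)

lemma images_lin:
  assumes "\<sigma> \<in> module_structures P scale"
  shows "lin (images \<sigma> x)"
  using module_structure_lin[OF assms gen_closed] by (simp add: images_def lin_iff)

text \<open>
  A module structure is determined by the action of the generators.  The lemmas below on relators,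
  equality of structures and invariant subspaces are read off from this formula.
\<close>

lemma module_structure_evaluate:
  assumes \<sigma>: "\<sigma> \<in> module_structures P scale" and p: "p \<in> carrier F"
  shows "\<sigma> (I +>\<^bsub>F\<^esub> p) = evaluate scale (images \<sigma>) p"
proof -
  let ?\<phi> = "\<lambda>p. \<sigma> (I +>\<^bsub>F\<^esub> p)"
  have hom: "\<sigma> \<in> ring_hom P (End_algebra scale)"
    and sc: "\<And>c a. a \<in> carrier P \<Longrightarrow> \<sigma> (c \<odot>\<^bsub>P\<^esub> a) = c \<odot>\<^bsub>End_algebra scale\<^esub> \<sigma> a"
    using \<sigma> by (auto simp: module_structures_def algebra_hom_def)
  have in_P: "I +>\<^bsub>F\<^esub> r \<in> carrier P" if "r \<in> carrier F" for r
    using that by (simp add: carrier_presented)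
  have mult: "?\<phi> (r * s) = ?\<phi> r \<circ> ?\<phi> s" if "r \<in> carrier F" "s \<in> carrier F" for r s
    using ring_hom_mult[OF hom in_P in_P] that by (simp add: presented_ops End_algebra_def)
  have add: "?\<phi> (r + s) = (\<lambda>v. ?\<phi> r v + ?\<phi> s v)" if "r \<in> carrier F" "s \<in> carrier F" for r s
    using ring_hom_add[OF hom in_P in_P] that by (simp add: presented_ops End_algebra_def)
  have one: "?\<phi> 1 = id"
    using ring_hom_one[OF hom] by (simp add: presented_one End_algebra_def)
  have scl: "?\<phi> (const c * r) = (\<lambda>v. scale c (?\<phi> r v))" if "r \<in> carrier F" for r c
    using sc[OF in_P[OF that]] that by (simp add: presented_ops End_algebra_def)
  have phi0: "?\<phi> 0 = (\<lambda>v. 0)"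
    using scl[of 1 0] F.one_closed by (simp add: const_def)
  have word: "?\<phi> (Poly_Mapping.single (Word xs) 1) = word_action (images \<sigma>) (Word xs)" if "set xs \<subseteq> X" for xs
    using that
  proof (induction xs)
    case Nil
    then show ?case using one by (simp flip: zero_word_def)
  next
    case (Cons x xs)
    have "Poly_Mapping.single (Word (x # xs)) 1 = letter x * Poly_Mapping.single (Word xs) (1::'k)"
      by (simp add: letter_def mult_single plus_word_def)
    moreover have "Poly_Mapping.single (Word xs) 1 \<in> carrier F"
      using Cons by (simp add: carrier_free)
    ultimately show ?case
      using Cons mult by (simp add: images_def presented_generator_def)
  qed
  let ?S = "{w. set (letters w) \<subseteq> X}"
  have "p \<in> carrier F \<and> ?\<phi> p = evaluate scale (images \<sigma>) p"
  proof (induction p rule: ncpoly_induct[where S = ?S])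
    case zero
    then show ?case using F.zero_closed phi0 by (simp add: evaluate_0 fun_eq_iff)
  next
    case (monomial p w c)
    let ?m = "Poly_Mapping.single w (1::'k)"
    have m: "?m \<in> carrier F" using monomial(2) by (simp add: carrier_free)
    have cm: "const c * ?m = Poly_Mapping.single w c"
      by (simp add: const_def mult_single)
    have cmc: "const c * ?m \<in> carrier F"
      using F.m_closed[OF const_closed m] by simp
    have "?\<phi> ?m = word_action (images \<sigma>) w"
      using word[of "letters w"] monomial(2) by simp
    then have "?\<phi> (p + const c * ?m) = evaluate scale (images \<sigma>) (p + Poly_Mapping.single w c)"
      using monomial(1) m cmc by (simp add: add scl fun_eq_iff evaluate_add evaluate_single)
    then show ?case
      using F.a_closed[OF _ cmc] monomial(1) cm by simp
  next
    show "Poly_Mapping.keys p \<subseteq> ?S" using p by (auto simp: carrier_free)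
  qed
  then show ?thesis ..
qed

lemma module_structure_relator:
  assumes \<sigma>: "\<sigma> \<in> module_structures P scale" and r: "r \<in> R"
  shows "evaluate scale (images \<sigma>) r v = 0"
proof -
  have "r \<in> carrier F" using r relators_closed by auto
  moreover have "r - 0 \<in> I"
    using r F.genideal_self[OF relators_closed] by auto
  ultimately have "I +>\<^bsub>F\<^esub> r = I +>\<^bsub>F\<^esub> 0"
    using coset_eq_iff[of r 0] F.zero_closed by simp
  then show ?thesis
    using module_structure_evaluate[OF \<sigma> \<open>r \<in> carrier F\<close>]
      module_structure_evaluate[OF \<sigma> F.zero_closed] by (simp add: evaluate_0)
qed

lemma module_structure_eqI:
  assumes \<sigma>: "\<sigma> \<in> module_structures P scale" and \<tau>: "\<tau> \<in> module_structures P scale"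
    and eq: "\<And>x. x \<in> X \<Longrightarrow> \<sigma> (gen x) = \<tau> (gen x)"
  shows "\<sigma> = \<tau>"
proof (rule extensionalityI)
  show "\<sigma> \<in> extensional (carrier P)" "\<tau> \<in> extensional (carrier P)"
    using \<sigma> \<tau> by (auto simp: module_structures_def)
  have "images \<sigma> = images \<tau>"
    using eq by (auto simp: images_def)
  then show "\<sigma> a = \<tau> a" if "a \<in> carrier P" for a
    using that module_structure_evaluate[OF \<sigma>] module_structure_evaluate[OF \<tau>]
    by (auto simp: carrier_presented)
qed

lemma invariant_subspace:
  assumes \<sigma>: "\<sigma> \<in> module_structures P scale" and W: "subspace W"
    and inv: "\<And>x w. x \<in> X \<Longrightarrow> w \<in> W \<Longrightarrow> \<sigma> (gen x) w \<in> W"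
    and a: "a \<in> carrier P" and w: "w \<in> W"
  shows "\<sigma> a w \<in> W"
proof -
  have "word_action (images \<sigma>) (Word xs) w \<in> W" for xs
    using w inv subspace_0[OF W] by (induction xs) (auto simp: images_def)
  then have "word_action (images \<sigma>) u w \<in> W" for u
    by (metis word.collapse)
  then have "evaluate scale (images \<sigma>) p w \<in> W" for p
    unfolding evaluate_def by (intro subspace_sum[OF W] subspace_scale[OF W])
  then show ?thesis
    using a module_structure_evaluate[OF \<sigma>] by (auto simp: carrier_presented)
qed

text \<open>
  The universal property: the polynomials that evaluate to \<open>0\<close> form an ideal, and it contains the
  ideal generated by the relators as soon as it contains the relators.
\<close>

lemma module_structure_exists:
  assumes lin: "\<And>x. x \<in> X \<Longrightarrow> lin (g x)"
    and rel: "\<And>r v. r \<in> R \<Longrightarrow> evaluate scale (\<lambda>x. if x \<in> X then g x else (\<lambda>v. 0)) r v = 0"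
  shows "\<exists>\<sigma>\<in>module_structures P scale. \<forall>x\<in>X. \<sigma> (gen x) = g x"
proof -
  define g' where "g' = (\<lambda>x. if x \<in> X then g x else (\<lambda>v. 0))"
  have g': "lin (g' x)" for x
    using lin by (auto simp: g'_def lin_iff)
  let ?e = "evaluate scale g'"
  let ?K = "{p \<in> carrier F. \<forall>v. ?e p v = 0}"
  have "ideal ?K F"
  proof (rule idealI)
    show "ring F" by (rule F.ring_axioms)
    show "subgroup ?K (add_monoid F)"
    proof (rule F.add.subgroupI)
      show "?K \<noteq> {}" using F.zero_closed by (auto simp: evaluate_0)
      show "\<ominus>\<^bsub>F\<^esub> p \<in> ?K" if "p \<in> ?K" for p
      proof -
        have "\<ominus>\<^bsub>F\<^esub> p = - p"
          using that F.minus_equality[of "- p" p] by (simp add: carrier_free)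
        then show ?thesis using that F.a_inv_closed[of p] by (simp add: evaluate_uminus)
      qed
    qed (use F.a_closed in \<open>auto simp: evaluate_add\<close>)
  qed (use F.m_closed in \<open>auto simp: evaluate_mult[OF g'] lin_0[OF lin_evaluate[OF g']]\<close>)
  then have IK: "I \<subseteq> ?K"
    using relators_closed rel by (intro F.genideal_minimal) (auto simp: g'_def)
  define rep where "rep a = (SOME p. p \<in> carrier F \<and> a = I +>\<^bsub>F\<^esub> p)" for a
  define \<sigma> where "\<sigma> = restrict (\<lambda>a. ?e (rep a)) (carrier P)"
  have \<sigma>: "\<sigma> (I +>\<^bsub>F\<^esub> p) = ?e p" if p: "p \<in> carrier F" for p
  proof -
    let ?r = "rep (I +>\<^bsub>F\<^esub> p)"
    have "?r \<in> carrier F \<and> I +>\<^bsub>F\<^esub> p = I +>\<^bsub>F\<^esub> ?r"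
      unfolding rep_def by (rule someI[of _ p]) (use p in simp)
    then have "p - ?r \<in> I"
      using coset_eq_iff[OF p, of ?r] by metis
    then have "?e p v = ?e ?r v" for v
      using IK evaluate_diff[of g' p ?r v] by auto
    moreover have "\<sigma> (I +>\<^bsub>F\<^esub> p) = ?e ?r"
      using p by (simp add: \<sigma>_def carrier_presented)
    ultimately show ?thesis by (simp add: fun_eq_iff)
  qed
  have "\<sigma> \<in> ring_hom P (End_algebra scale)"
  proof (rule ring_hom_memI)
    show "\<sigma> a \<in> carrier (End_algebra scale)" if "a \<in> carrier P" for a
      using that \<sigma> lin_evaluate[OF g'] by (auto simp: carrier_presented carrier_End)
    fix a b assume "a \<in> carrier P" "b \<in> carrier P"
    then obtain p r where pr: "p \<in> carrier F" "r \<in> carrier F"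
      and ab: "a = I +>\<^bsub>F\<^esub> p" "b = I +>\<^bsub>F\<^esub> r"
      by (auto simp: carrier_presented)
    show "\<sigma> (a \<otimes>\<^bsub>P\<^esub> b) = \<sigma> a \<otimes>\<^bsub>End_algebra scale\<^esub> \<sigma> b"
      and "\<sigma> (a \<oplus>\<^bsub>P\<^esub> b) = \<sigma> a \<oplus>\<^bsub>End_algebra scale\<^esub> \<sigma> b"
      using F.m_closed[OF pr] F.a_closed[OF pr]
      by (simp_all add: ab pr presented_ops \<sigma> End_algebra_def fun_eq_iff
          evaluate_mult[OF g'] evaluate_add)
  next
    show "\<sigma> \<one>\<^bsub>P\<^esub> = \<one>\<^bsub>End_algebra scale\<^esub>"
      using F.one_closed
      by (simp add: presented_one \<sigma> End_algebra_def fun_eq_iff evaluate_1)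
  qed
  moreover have "\<sigma> (c \<odot>\<^bsub>P\<^esub> a) = c \<odot>\<^bsub>End_algebra scale\<^esub> \<sigma> a" if "a \<in> carrier P" for c a
  proof -
    from that obtain p where p: "p \<in> carrier F" and a: "a = I +>\<^bsub>F\<^esub> p"
      by (auto simp: carrier_presented)
    show ?thesis
      using F.m_closed[OF const_closed p]
      by (simp add: a p presented_ops \<sigma> End_algebra_def fun_eq_iff evaluate_mult[OF g'] evaluate_const)
  qed
  ultimately have "\<sigma> \<in> module_structures P scale"
    by (auto simp: module_structures_def algebra_hom_def \<sigma>_def)
  moreover have "\<sigma> (gen x) = g x" if "x \<in> X" for x
    using that \<sigma>[OF letter_closed[OF that]]
    by (simp add: presented_generator_def evaluate_letter g'_def fun_eq_iff)
  ultimately show ?thesis by blast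
qed

end

section \<open>Sums of subspaces\<close>

context operators
begin

definition sum_space :: "(int \<Rightarrow> 'v set) \<Rightarrow> int set \<Rightarrow> 'v set" where
  "sum_space V S = {\<Sum>m\<in>S. f m | f. \<forall>m\<in>S. f m \<in> V m}"

lemma sum_spaceI: "(\<And>m. m \<in> S \<Longrightarrow> f m \<in> V m) \<Longrightarrow> (\<Sum>m\<in>S. f m) \<in> sum_space V S"
  by (auto simp: sum_space_def)

lemma sum_space_image:
  assumes "lin L" "subspace U" "\<And>m u. m \<in> S \<Longrightarrow> u \<in> V m \<Longrightarrow> L u \<in> U" "v \<in> sum_space V S"
  shows "L v \<in> U"
  using assms by (auto simp: sum_space_def lin_sum[OF assms(1)] intro!: subspace_sum)

lemma lin_id: "lin (\<lambda>v. v)"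
  by (simp add: lin_iff)

lemma lin_minus_scale: "lin X \<Longrightarrow> lin (\<lambda>v. X v - scale c v)"
  by (simp add: lin_iff algebra_simps)

lemma sum_space_least:
  assumes "subspace U" "\<And>m. m \<in> S \<Longrightarrow> V m \<subseteq> U"
  shows "sum_space V S \<subseteq> U"
  using sum_space_image[OF lin_id assms(1), of S V] assms(2) by blast

lemma subspace_sum_space:
  assumes "\<And>m. m \<in> S \<Longrightarrow> subspace (V m)"
  shows "subspace (sum_space V S)"
proof (rule subspaceI)
  show "0 \<in> sum_space V S"
    using sum_spaceI[of S "\<lambda>_. 0" V] assms by (simp add: subspace_0)
  show "u + v \<in> sum_space V S" if "u \<in> sum_space V S" "v \<in> sum_space V S" for u v
    using that assms unfolding sum_space_def
    by (force simp: subspace_add simp flip: sum.distrib)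
  show "scale c v \<in> sum_space V S" if "v \<in> sum_space V S" for c v
    using that assms unfolding sum_space_def
    by (force simp: subspace_scale scale_sum_right)
qed

lemma sum_space_incl:
  assumes "finite S" "m \<in> S" "\<And>m. m \<in> S \<Longrightarrow> subspace (V m)"
  shows "V m \<subseteq> sum_space V S"
proof
  fix v assume "v \<in> V m"
  then have "(\<Sum>i\<in>S. if i = m then v else 0) \<in> sum_space V S"
    using assms(3) by (intro sum_spaceI) (auto simp: subspace_0)
  then show "v \<in> sum_space V S" using assms(1,2) by simp
qed

lemma sum_space_mono:
  assumes "finite T" "S \<subseteq> T" "\<And>m. m \<in> T \<Longrightarrow> subspace (V m)"
  shows "sum_space V S \<subseteq> sum_space V T"
  using assms by (intro sum_space_least subspace_sum_space sum_space_incl) auto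

lemma lin_eqI:
  assumes "lin X" "lin Y" "sum_space V S = UNIV" "\<And>m u. m \<in> S \<Longrightarrow> u \<in> V m \<Longrightarrow> X u = Y u"
  shows "X v = Y v"
proof -
  have L: "lin (\<lambda>v. X v - Y v)"
    using assms(1,2) by (simp add: lin_iff algebra_simps)
  have 0: "subspace {0}" by (simp add: subspace_def)
  have "X v - Y v \<in> {0}"
    by (rule sum_space_image[OF L 0, of S V]) (simp_all add: assms(3,4))
  then show ?thesis by simp
qed

definition irreducible_pair :: "('v \<Rightarrow> 'v) \<Rightarrow> ('v \<Rightarrow> 'v) \<Rightarrow> bool" where
  "irreducible_pair A B \<longleftrightarrow>
    (\<forall>W. subspace W \<and> (\<forall>w\<in>W. A w \<in> W \<and> B w \<in> W) \<longrightarrow> W = {0} \<or> W = UNIV)"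

lemma irreducible_pair_sym: "irreducible_pair A B \<Longrightarrow> irreducible_pair B A"
  by (simp add: irreducible_pair_def conj_commute)

definition eigenspace where
  "eigenspace X c = {v. X v = scale c v}"

lemma subspace_eigenspace: "lin X \<Longrightarrow> subspace (eigenspace X c)"
  by (simp add: subspace_def eigenspace_def lin_0 lin_add lin_scale scale_right_distrib ac_simps)

end

section \<open>Opposite flags\<close>

locale flags = operators scale
  for scale :: "'k::field \<Rightarrow> 'v::ab_group_add \<Rightarrow> 'v" +
  fixes d :: int
  assumes d_nonneg: "0 \<le> d"
begin

text \<open>
  Flags are indexed by all integers, with constant values outside \<open>{0..d}\<close>, so that the index shifts
  \<open>n - 1\<close>, \<open>n + 1\<close> and \<open>d - n\<close> need no case distinctions.
\<close>

definition is_flag :: "(int \<Rightarrow> 'v set) \<Rightarrow> bool" where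
  "is_flag F \<longleftrightarrow> (\<forall>n. subspace (F n)) \<and> (\<forall>m n. m \<le> n \<longrightarrow> F m \<subseteq> F n) \<and>
    (\<forall>n<0. F n = {0}) \<and> (\<forall>n\<ge>d. F n = UNIV)"

text \<open>
  The \<open>n\<close>-th summand of the decomposition of the space that two opposite flags define.
\<close>

definition meet :: "(int \<Rightarrow> 'v set) \<Rightarrow> (int \<Rightarrow> 'v set) \<Rightarrow> int \<Rightarrow> 'v set" where
  "meet F G n = F n \<inter> G (d - n)"

definition opposite :: "(int \<Rightarrow> 'v set) \<Rightarrow> (int \<Rightarrow> 'v set) \<Rightarrow> bool" where
  "opposite F G \<longleftrightarrow> is_flag F \<and> is_flag G \<and> (\<forall>m n. m + n < d \<longrightarrow> F m \<inter> G n = {0}) \<and>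
    sum_space (meet F G) {0..d} = UNIV"

definition strict :: "(int \<Rightarrow> 'v set) \<Rightarrow> bool" where
  "strict F \<longleftrightarrow> (\<forall>n\<in>{0..d}. F n \<noteq> F (n - 1))"

text \<open>
  For a flag \<open>F\<close> this says that \<open>X\<close> preserves \<open>F\<close> and induces the scalar \<open>c n\<close> on \<open>F n / F (n - 1)\<close>.
\<close>

definition acts :: "('v \<Rightarrow> 'v) \<Rightarrow> (int \<Rightarrow> 'k) \<Rightarrow> (int \<Rightarrow> 'v set) \<Rightarrow> bool" where
  "acts X c F \<longleftrightarrow> (\<forall>n. \<forall>v\<in>F n. X v - scale (c n) v \<in> F (n - 1))"

definition raises :: "('v \<Rightarrow> 'v) \<Rightarrow> (int \<Rightarrow> 'v set) \<Rightarrow> bool" where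
  "raises X F \<longleftrightarrow> (\<forall>n. \<forall>v\<in>F n. X v \<in> F (n + 1))"

text \<open>
  The summand \<open>meet F G n\<close> projects isomorphically onto \<open>F n / F (n - 1)\<close> and onto
  \<open>G (d - n) / G (d - n - 1)\<close>.  This is why the scalars appear in reverse order on \<open>G\<close>: such an
  \<open>X\<close> is the operator with eigenvalue \<open>c n\<close> on \<open>meet F G n\<close>.
\<close>

definition edge :: "(int \<Rightarrow> 'k) \<Rightarrow> (int \<Rightarrow> 'v set) \<Rightarrow> (int \<Rightarrow> 'v set) \<Rightarrow> ('v \<Rightarrow> 'v) \<Rightarrow> bool" where
  "edge c F G X \<longleftrightarrow> opposite F G \<and> lin X \<and> acts X c F \<and> acts X (\<lambda>n. c (d - n)) G"

lemma flag_subspace: "is_flag F \<Longrightarrow> subspace (F n)"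
  and flag_mono: "is_flag F \<Longrightarrow> m \<le> n \<Longrightarrow> v \<in> F m \<Longrightarrow> v \<in> F n"
  and flag_neg: "is_flag F \<Longrightarrow> n < 0 \<Longrightarrow> F n = {0}"
  and flag_top: "is_flag F \<Longrightarrow> n \<ge> d \<Longrightarrow> F n = UNIV"
  by (auto simp: is_flag_def)

lemma actsD: "acts X c F \<Longrightarrow> v \<in> F n \<Longrightarrow> m = n - 1 \<Longrightarrow> X v - scale (c n) v \<in> F m"
  by (simp add: acts_def)

lemma raisesD: "raises X F \<Longrightarrow> v \<in> F n \<Longrightarrow> m = n + 1 \<Longrightarrow> X v \<in> F m"
  by (simp add: raises_def)

lemma opposite_flags: "opposite F G \<Longrightarrow> is_flag F" "opposite F G \<Longrightarrow> is_flag G"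
  by (auto simp: opposite_def)

lemma opposite_zero: "opposite F G \<Longrightarrow> m + n < d \<Longrightarrow> v \<in> F m \<Longrightarrow> v \<in> G n \<Longrightarrow> v = 0"
  by (auto simp: opposite_def)

lemma opposite_decompose:
  assumes "opposite F G"
  shows "\<exists>f. (\<forall>n\<in>{0..d}. f n \<in> meet F G n) \<and> v = (\<Sum>n\<in>{0..d}. f n)"
proof -
  have "v \<in> sum_space (meet F G) {0..d}" using assms by (simp add: opposite_def)
  then show ?thesis by (auto simp: sum_space_def)
qed

lemma subspace_meet: "opposite F G \<Longrightarrow> subspace (meet F G n)"
  by (simp add: meet_def subspace_inter flag_subspace opposite_flags)

lemma meet_sym: "meet G F n = meet F G (d - n)"
  by (auto simp: meet_def)

lemma sum_space_reverse: "sum_space (\<lambda>n. V (d - n)) {0..d} = sum_space V {0..d}"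
proof -
  have sub: "sum_space (\<lambda>n. V (d - n)) {0..d} \<subseteq> sum_space V {0..d}" for V
  proof
    fix v assume "v \<in> sum_space (\<lambda>n. V (d - n)) {0..d}"
    then obtain f where f: "\<forall>n\<in>{0..d}. f n \<in> V (d - n)" "v = (\<Sum>n\<in>{0..d}. f n)"
      by (auto simp: sum_space_def)
    have "v = (\<Sum>n\<in>{0..d}. f (d - n))"
      unfolding f(2) by (rule sum.reindex_bij_witness[of _ "\<lambda>n. d - n" "\<lambda>n. d - n"]) auto
    moreover have "f (d - n) \<in> V n" if "n \<in> {0..d}" for n
      using f(1)[rule_format, of "d - n"] that by simp
    ultimately show "v \<in> sum_space V {0..d}"
      using sum_spaceI[of "{0..d}" "\<lambda>n. f (d - n)" V] by simp
  qed
  from sub[of V] sub[of "\<lambda>n. V (d - n)"] show ?thesis by auto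
qed

lemma opposite_sym:
  assumes "opposite F G"
  shows "opposite G F"
proof -
  have "meet G F = (\<lambda>n. meet F G (d - n))"
    by (rule ext) (rule meet_sym)
  then have "sum_space (meet G F) {0..d} = UNIV"
    using assms by (simp add: sum_space_reverse opposite_def)
  moreover have "G m \<inter> F n = {0}" if "m + n < d" for m n
  proof -
    have "n + m < d" using that by simp
    then have "F n \<inter> G m = {0}" using assms unfolding opposite_def by blast
    then show ?thesis by blast
  qed
  ultimately show ?thesis
    using assms unfolding opposite_def by blast
qed

text \<open>
  In a vanishing sum the term with the largest index \<open>N\<close> lies in \<open>F (N - 1)\<close>, like all the others,
  and in \<open>G (d - N)\<close>; these two spaces meet in \<open>0\<close>.
\<close>

lemma meet_independent:
  assumes opp: "opposite F G"
    and "finite S" "\<And>n. n \<in> S \<Longrightarrow> f n \<in> meet F G n" "(\<Sum>n\<in>S. f n) = 0" "n \<in> S"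
  shows "f n = 0"
  using assms(2-)
proof (induction S arbitrary: n rule: finite_linorder_max_induct)
  case (insert N S)
  have N: "N \<notin> S" "\<And>m. m \<in> S \<Longrightarrow> m \<le> N - 1" and fN: "f N \<in> meet F G N"
    and fS: "\<And>m. m \<in> S \<Longrightarrow> f m \<in> meet F G m"
    using insert.hyps(2) insert.prems(1) by auto
  have "f m \<in> F (N - 1)" if "m \<in> S" for m
    using fS[OF that] N(2)[OF that] by (auto simp: meet_def intro: flag_mono[OF opposite_flags(1)[OF opp]])
  then have "(\<Sum>n\<in>S. f n) \<in> F (N - 1)"
    by (intro subspace_sum flag_subspace opposite_flags[OF opp])
  moreover have sum: "f N + (\<Sum>n\<in>S. f n) = 0"
    using insert.prems(2) insert.hyps(1) N(1) by simp
  then have "f N = - (\<Sum>n\<in>S. f n)"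
    by (simp add: eq_neg_iff_add_eq_0)
  ultimately have "f N \<in> F (N - 1)"
    by (simp add: subspace_neg flag_subspace opposite_flags[OF opp])
  moreover have "f N \<in> G (d - N)"
    using fN by (simp add: meet_def)
  ultimately have "f N = 0"
    by (intro opposite_zero[OF opp, of "N - 1" "d - N"]) auto
  then show ?case
    using insert.IH[OF fS] sum insert.prems(3) by auto
qed simp

text \<open>
  If the last summand of \<open>v\<close> has an index \<open>k + 1 > n\<close>, then it is a difference of vectors in \<open>F k\<close>,
  and it lies in \<open>G (d - (k + 1))\<close>, so it vanishes.  Thus the summands beyond \<open>n\<close> can be removed one by one.
\<close>

lemma flag_sum_space:
  assumes opp: "opposite F G" and v: "v \<in> F n"
  shows "v \<in> sum_space (meet F G) {0..n}"
proof -
  let ?M = "meet F G"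
  note F = opposite_flags(1)[OF opp]
  have sub: "subspace (?M m)" for m
    using subspace_meet[OF opp] .
  have "v \<in> sum_space ?M {0..k} \<longrightarrow> v \<in> sum_space ?M {0..n}" if "k \<ge> n" for k
    using that
  proof (induction k rule: int_ge_induct)
    case (step k)
    show ?case
    proof
      assume "v \<in> sum_space ?M {0..k + 1}"
      then obtain f where f: "\<forall>m\<in>{0..k + 1}. f m \<in> ?M m" and v_eq: "v = (\<Sum>m\<in>{0..k + 1}. f m)"
        by (auto simp: sum_space_def)
      have "v \<in> sum_space ?M {0..k}"
      proof (cases "k + 1 < 0")
        case True
        then show ?thesis using v_eq sub subspace_0[OF subspace_sum_space, of "{0..k}" ?M] by simp
      next
        case False
        then have "{0..k + 1} = insert (k + 1) {0..k}" by auto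
        then have split: "v = f (k + 1) + (\<Sum>m\<in>{0..k}. f m)"
          using v_eq by simp
        have "f m \<in> F k" if "m \<in> {0..k}" for m
          using f that flag_mono[OF F, of m k "f m"] by (auto simp: meet_def)
        then have "(\<Sum>m\<in>{0..k}. f m) \<in> F k"
          by (intro subspace_sum flag_subspace F)
        moreover have "v \<in> F k" using flag_mono[OF F _ v] step by simp
        ultimately have "f (k + 1) \<in> F k"
          using split subspace_diff[OF flag_subspace[OF F], of v k "\<Sum>m\<in>{0..k}. f m"] by simp
        moreover have "f (k + 1) \<in> G (d - (k + 1))"
          using f False by (auto simp: meet_def)
        ultimately have "f (k + 1) = 0"
          by (intro opposite_zero[OF opp, of k "d - (k + 1)"]) auto
        then show ?thesis using split f by (auto intro: sum_spaceI)
      qed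
      then show "v \<in> sum_space ?M {0..n}" using step by blast
    qed
  qed simp
  moreover have "v \<in> sum_space ?M {0..max n d}"
    using opp sum_space_mono[of "{0..max n d}" "{0..d}" ?M] sub by (auto simp: opposite_def)
  ultimately show ?thesis using max.cobounded1 by blast
qed

text \<open>
  The symmetry of the right-hand side in \<open>F\<close> and \<open>G\<close> is what transfers strictness from one flag to
  an opposite one.
\<close>

lemma strict_iff_meet:
  assumes opp: "opposite F G"
  shows "strict F \<longleftrightarrow> (\<forall>n\<in>{0..d}. meet F G n \<noteq> {0})"
proof -
  note F = opposite_flags(1)[OF opp]
  have "F n = F (n - 1) \<longleftrightarrow> meet F G n = {0}" for n
  proof
    assume "F n = F (n - 1)"
    then have "meet F G n \<subseteq> {0}"
      using opposite_zero[OF opp, of "n - 1" "d - n"] by (auto simp: meet_def)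
    then show "meet F G n = {0}"
      using subspace_0[OF subspace_meet[OF opp]] by auto
  next
    assume 0: "meet F G n = {0}"
    have "sum_space (meet F G) {0..n} \<subseteq> F (n - 1)"
    proof (rule sum_space_least[OF flag_subspace[OF F]])
      fix m assume "m \<in> {0..n}"
      then show "meet F G m \<subseteq> F (n - 1)"
        using 0 subspace_0[OF flag_subspace[OF F]] flag_mono[OF F, of m "n - 1"]
        by (cases "m = n") (auto simp: meet_def)
    qed
    then show "F n = F (n - 1)"
      using flag_sum_space[OF opp] flag_mono[OF F, of "n - 1" n] by auto
  qed
  then show ?thesis by (auto simp: strict_def)
qed

lemma strict_opposite:
  assumes "opposite F G" "strict F"
  shows "strict G"
proof -
  have "meet G F n \<noteq> {0}" if "n \<in> {0..d}" for n
    using that assms(2)[unfolded strict_iff_meet[OF assms(1)]]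
    by (auto simp: meet_sym[of G F])
  then show ?thesis using strict_iff_meet[OF opposite_sym[OF assms(1)]] by simp
qed

lemma edge_opposite: "edge c F G X \<Longrightarrow> opposite F G"
  and edge_lin: "edge c F G X \<Longrightarrow> lin X"
  by (auto simp: edge_def)

lemma edge_sym: "edge c F G X \<Longrightarrow> edge (\<lambda>n. c (d - n)) G F X"
  by (simp add: edge_def opposite_sym)

lemma edge_eigen:
  assumes "edge c F G X" "v \<in> meet F G n"
  shows "X v = scale (c n) v"
proof -
  have "X v - scale (c n) v \<in> F (n - 1)"
    using assms actsD[of X c F v n "n - 1"] by (simp add: edge_def meet_def)
  moreover have "X v - scale (c n) v \<in> G (d - n - 1)"
    using assms actsD[of X "\<lambda>n. c (d - n)" G v "d - n" "d - n - 1"]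
    by (simp add: edge_def meet_def)
  ultimately have "X v - scale (c n) v = 0"
    by (intro opposite_zero[OF edge_opposite[OF assms(1)]]) auto
  then show ?thesis by simp
qed

lemma edge_eigenspace:
  assumes e: "edge c F G X" and "inj c"
  shows "eigenspace X (c m) = meet F G m"
proof
  note opp = edge_opposite[OF e]
  show "meet F G m \<subseteq> eigenspace X (c m)"
    using edge_eigen[OF e] by (auto simp: eigenspace_def)
  show "eigenspace X (c m) \<subseteq> meet F G m"
  proof
    fix w assume "w \<in> eigenspace X (c m)"
    then have w: "X w = scale (c m) w" by (simp add: eigenspace_def)
    obtain f where f: "\<forall>n\<in>{0..d}. f n \<in> meet F G n" and w_eq: "w = (\<Sum>n\<in>{0..d}. f n)"
      using opposite_decompose[OF opp] by blast
    have "(\<Sum>n\<in>{0..d}. scale (c n - c m) (f n)) = (\<Sum>n\<in>{0..d}. X (f n) - scale (c m) (f n))"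
      by (rule sum.cong) (simp_all only: edge_eigen[OF e bspec[OF f]] scale_left_diff_distrib)
    also have "\<dots> = X w - scale (c m) w"
      by (simp add: w_eq lin_sum[OF edge_lin[OF e]] scale_sum_right sum_subtractf)
    finally have sum0: "(\<Sum>n\<in>{0..d}. scale (c n - c m) (f n)) = 0"
      using w by simp
    have "scale (c n - c m) (f n) = 0" if "n \<in> {0..d}" for n
      by (rule meet_independent[OF opp _ _ sum0 that])
        (use f subspace_scale[OF subspace_meet[OF opp]] in auto)
    then have "f n = 0" if "n \<in> {0..d}" "n \<noteq> m" for n
      using that \<open>inj c\<close> by (auto simp: inj_eq)
    then have "w = (\<Sum>n\<in>{0..d}. if n = m then f m else 0)"
      unfolding w_eq by (intro sum.cong) auto
    then show "w \<in> meet F G m"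
      using f subspace_0[OF subspace_meet[OF opp]] by (auto simp: sum.delta)
  qed
qed

lemma edge_unique:
  assumes "edge c F G X" "edge c F G Y"
  shows "X = Y"
proof
  have S: "sum_space (meet F G) {0..d} = UNIV"
    using assms(1) by (simp add: edge_def opposite_def)
  show "X v = Y v" for v
    by (rule lin_eqI[OF edge_lin[OF assms(1)] edge_lin[OF assms(2)] S])
      (simp add: edge_eigen[OF assms(1)] edge_eigen[OF assms(2)])
qed

lemma acts_of_eigen:
  assumes opp: "opposite F G" and X: "lin X"
    and eig: "\<And>n v. v \<in> meet F G n \<Longrightarrow> X v = scale (c n) v"
  shows "acts X c F"
  unfolding acts_def
proof (intro allI ballI)
  note F = opposite_flags(1)[OF opp]
  fix n v assume "v \<in> F n"
  then have "v \<in> sum_space (meet F G) {0..n}" by (rule flag_sum_space[OF opp])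
  then show "X v - scale (c n) v \<in> F (n - 1)"
  proof (rule sum_space_image[OF lin_minus_scale[OF X] flag_subspace[OF F], rotated])
    fix m u assume m: "m \<in> {0..n}" and u: "u \<in> meet F G m"
    show "X u - scale (c n) u \<in> F (n - 1)"
    proof (cases "m = n")
      case True
      then show ?thesis using eig u subspace_0[OF flag_subspace[OF F]] by simp
    next
      case False
      then have "u \<in> F (n - 1)"
        using m u flag_mono[OF F, of m "n - 1"] by (auto simp: meet_def)
      then show ?thesis
        using eig[OF u] flag_subspace[OF F] by (simp add: subspace_diff subspace_scale)
    qed
  qed
qed

lemma edge_exists:
  assumes opp: "opposite F G"
  shows "\<exists>X. edge c F G X"
proof -
  let ?M = "meet F G"
  obtain f where f: "\<And>v n. n \<in> {0..d} \<Longrightarrow> f v n \<in> ?M n" and v_eq: "\<And>v. v = (\<Sum>n\<in>{0..d}. f v n)"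
    using opposite_decompose[OF opp] by metis
  define X where "X v = (\<Sum>n\<in>{0..d}. scale (c n) (f v n))" for v
  have X: "X (\<Sum>n\<in>{0..d}. g n) = (\<Sum>n\<in>{0..d}. scale (c n) (g n))"
    if g: "\<And>n. n \<in> {0..d} \<Longrightarrow> g n \<in> ?M n" for g
  proof -
    let ?v = "\<Sum>n\<in>{0..d}. g n"
    have sum0: "(\<Sum>n\<in>{0..d}. g n - f ?v n) = 0"
      unfolding sum_subtractf right_minus_eq by (rule v_eq)
    have eq0: "g n - f ?v n = 0" if "n \<in> {0..d}" for n
      by (rule meet_independent[OF opp _ _ sum0 that])
        (simp_all add: g f subspace_diff[OF subspace_meet[OF opp]])
    then have "f ?v n = g n" if "n \<in> {0..d}" for n
      using eq0[OF that] by (simp only: right_minus_eq)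
    then show ?thesis unfolding X_def by (intro sum.cong) simp_all
  qed
  have X_lin: "lin X"
    unfolding lin_iff
  proof (intro conjI allI)
    fix u v b
    have "u + v = (\<Sum>n\<in>{0..d}. f u n + f v n)"
      by (simp only: sum.distrib v_eq[symmetric])
    then have "X (u + v) = (\<Sum>n\<in>{0..d}. scale (c n) (f u n + f v n))"
      using X[of "\<lambda>n. f u n + f v n"] f by (simp add: subspace_add subspace_meet[OF opp])
    then show "X (u + v) = X u + X v"
      by (simp add: X_def scale_right_distrib sum.distrib)
    have "scale b v = (\<Sum>n\<in>{0..d}. scale b (f v n))"
      by (simp only: scale_sum_right[symmetric] v_eq[symmetric])
    then have "X (scale b v) = (\<Sum>n\<in>{0..d}. scale (c n) (scale b (f v n)))"
      using X[of "\<lambda>n. scale b (f v n)"] f by (simp add: subspace_scale subspace_meet[OF opp])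
    then show "X (scale b v) = scale b (X v)"
      by (simp add: X_def scale_sum_right mult.commute)
  qed
  have eig: "X v = scale (c n) v" if v: "v \<in> ?M n" for v n
  proof (cases "n \<in> {0..d}")
    case True
    have "X (\<Sum>i\<in>{0..d}. if i = n then v else 0) = (\<Sum>i\<in>{0..d}. scale (c i) (if i = n then v else 0))"
      using v by (intro X) (auto simp: subspace_0[OF subspace_meet[OF opp]])
    also have "\<dots> = (\<Sum>i\<in>{0..d}. if i = n then scale (c n) v else 0)"
      by (intro sum.cong) auto
    finally show ?thesis using True by simp
  next
    case False
    then have "v = 0"
      using v flag_neg[OF opposite_flags(1)[OF opp], of n] flag_neg[OF opposite_flags(2)[OF opp], of "d - n"]
      by (auto simp: meet_def)
    then show ?thesis using lin_0[OF X_lin] by simp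
  qed
  have "acts X c F"
    using acts_of_eigen[OF opp X_lin] eig by blast
  moreover have "acts X (\<lambda>n. c (d - n)) G"
    using acts_of_eigen[OF opposite_sym[OF opp] X_lin] eig by (simp add: meet_sym[of G F])
  ultimately show ?thesis using opp X_lin by (auto simp: edge_def)
qed

section \<open>The split decomposition\<close>

text \<open>
  Let \<open>W s\<close> be the sum of the spaces \<open>F n \<inter> G (s - n)\<close>.  On such a space \<open>A - a n\<close> lowers the index
  of \<open>F\<close> and raises that of \<open>G\<close>, while \<open>B - b (s - n)\<close> does the opposite; the sum of the indices stays
  \<open>s\<close>.  So \<open>W s\<close> is invariant, hence \<open>0\<close> or everything.  For \<open>s < d\<close> it lies in the proper
  subspace \<open>F (d - 1)\<close> and must be \<open>0\<close>; for \<open>s = d\<close> it contains \<open>F 0\<close> and must be everything.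
\<close>

lemma opposite_of_irreducible:
  assumes F: "is_flag F" "strict F" and G: "is_flag G"
    and A: "lin A" "acts A a F" "raises A G"
    and B: "lin B" "acts B b G" "raises B F"
    and irr: "irreducible_pair A B"
  shows "opposite F G"
proof -
  define V where "V s n = F n \<inter> G (s - n)" for s n
  have sub: "subspace (V s n)" for s n
    using F G by (simp add: V_def subspace_inter flag_subspace)
  have V_neg: "V s n = {0}" if "n \<notin> {0..s}" for s n
    using that flag_neg[OF F(1), of n] flag_neg[OF G, of "s - n"]
      subspace_0[OF flag_subspace[OF F(1)]] subspace_0[OF flag_subspace[OF G]]
    by (auto simp: V_def)
  define W where "W s = sum_space (V s) {0..s}" for s
  have W_sub: "subspace (W s)" for s
    unfolding W_def using sub by (intro subspace_sum_space)
  have V_W: "V s n \<subseteq> W s" for s n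
    using V_neg[of n s] subspace_0[OF W_sub, of s] sum_space_incl[of "{0..s}" n "V s"] sub
    by (cases "n \<in> {0..s}") (auto simp: W_def)
  have W_A: "A w \<in> W s" if "w \<in> W s" for s w
    using that unfolding W_def
  proof (rule sum_space_image[OF A(1) W_sub[unfolded W_def], rotated])
    fix n u assume u: "u \<in> V s n"
    have "A u - scale (a n) u \<in> F (n - 1)"
      using A(2) u by (simp add: acts_def V_def)
    moreover have "A u - scale (a n) u \<in> G (s - (n - 1))"
    proof (rule subspace_diff[OF flag_subspace[OF G] _ subspace_scale[OF flag_subspace[OF G]]])
      show "A u \<in> G (s - (n - 1))"
        using raisesD[OF A(3), of u "s - n" "s - (n - 1)"] u by (simp add: V_def)
      show "u \<in> G (s - (n - 1))"
        using u flag_mono[OF G, of "s - n" "s - (n - 1)"] by (auto simp: V_def)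
    qed
    ultimately have "A u - scale (a n) u \<in> W s"
      using V_W[of s "n - 1"] by (auto simp: V_def)
    moreover have "u \<in> W s" using V_W u by auto
    ultimately have "(A u - scale (a n) u) + scale (a n) u \<in> W s"
      using W_sub by (intro subspace_add subspace_scale)
    then show "A u \<in> sum_space (V s) {0..s}" by (simp add: W_def)
  qed
  have W_B: "B w \<in> W s" if "w \<in> W s" for s w
    using that unfolding W_def
  proof (rule sum_space_image[OF B(1) W_sub[unfolded W_def], rotated])
    fix n u assume u: "u \<in> V s n"
    let ?b = "b (s - n)"
    have "B u - scale ?b u \<in> G (s - n - 1)"
      using B(2) u by (simp add: acts_def V_def)
    moreover have "s - n - 1 = s - (n + 1)" by simp
    moreover have "B u - scale ?b u \<in> F (n + 1)"
    proof (rule subspace_diff[OF flag_subspace[OF F(1)] _ subspace_scale[OF flag_subspace[OF F(1)]]])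
      show "B u \<in> F (n + 1)"
        using B(3) u by (simp add: raises_def V_def)
      show "u \<in> F (n + 1)"
        using u flag_mono[OF F(1), of n "n + 1"] by (auto simp: V_def)
    qed
    ultimately have "B u - scale ?b u \<in> W s"
      using V_W[of s "n + 1"] by (auto simp: V_def)
    moreover have "u \<in> W s" using V_W u by auto
    ultimately have "(B u - scale ?b u) + scale ?b u \<in> W s"
      using W_sub by (intro subspace_add subspace_scale)
    then show "B u \<in> sum_space (V s) {0..s}" by (simp add: W_def)
  qed
  have W_cases: "W s = {0} \<or> W s = UNIV" for s
    using irr W_sub W_A W_B unfolding irreducible_pair_def by blast
  have "F m \<inter> G n = {0}" if mn: "m + n < d" for m n
  proof -
    let ?s = "m + n"
    have "W ?s \<subseteq> F (d - 1)"
      unfolding W_def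
    proof (rule sum_space_least[OF flag_subspace[OF F(1)]])
      fix i assume "i \<in> {0..?s}"
      then show "V ?s i \<subseteq> F (d - 1)"
        using mn flag_mono[OF F(1), of i "d - 1"] by (auto simp: V_def)
    qed
    moreover have "F d \<noteq> F (d - 1)"
      using F(2) d_nonneg by (simp add: strict_def)
    then have "F (d - 1) \<noteq> UNIV"
      using flag_top[OF F(1), of d] by simp
    ultimately have "W ?s = {0}" using W_cases[of ?s] by auto
    then show ?thesis
      using V_W[of ?s m] subspace_0[OF sub, of ?s m] by (auto simp: V_def)
  qed
  moreover have "W d = UNIV"
  proof -
    have "F 0 \<noteq> F (0 - 1)"
      using F(2)[unfolded strict_def, rule_format, of 0] d_nonneg by simp
    then have "F 0 \<noteq> {0}"
      using flag_neg[OF F(1), of "-1"] by simp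
    moreover have "F 0 \<subseteq> W d"
      using V_W[of d 0] flag_top[OF G, of d] by (auto simp: V_def)
    ultimately have "W d \<noteq> {0}"
      using subspace_0[OF flag_subspace[OF F(1)], of 0] by auto
    then show ?thesis using W_cases by auto
  qed
  moreover have "V d = meet F G" by (auto simp: V_def meet_def)
  ultimately show ?thesis using F G by (auto simp: opposite_def W_def)
qed

end

section \<open>The \<open>q\<close>-Weyl relation\<close>

definition generic :: "'k::field \<Rightarrow> bool" where
  "generic q \<longleftrightarrow> q \<noteq> 0 \<and> (\<forall>n::nat. n > 0 \<longrightarrow> q ^ n \<noteq> 1)"

lemma generic_nonzero: "generic q \<Longrightarrow> q \<noteq> 0"
  by (simp add: generic_def)

text \<open>
  Replacing \<open>q\<close> by its inverse reverses the order of the eigenvalues and interchanges the two factors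
  in the \<open>q\<close>-Weyl relation.  This symmetry halves most of the arguments below.
\<close>

lemma generic_inverse: "generic q \<Longrightarrow> generic (inverse q)"
  by (simp add: generic_def power_inverse)

lemma generic_inj: "generic q \<Longrightarrow> inj (\<lambda>n::int. q powi n)"
proof (rule linorder_injI)
  fix m n :: int
  assume q: "generic q" and "m < n"
  then have "q powi (n - m) = q ^ nat (n - m)" "0 < nat (n - m)"
    by (simp_all add: power_int_def)
  then have "q powi (n - m) \<noteq> 1"
    using q unfolding generic_def by metis
  then show "q powi m \<noteq> q powi n"
    using q by (auto simp: power_int_diff generic_def)
qed

lemma generic_diff:
  assumes "generic q"
  shows "q - inverse q \<noteq> 0"
proof
  assume "q - inverse q = 0"
  then have "q ^ 2 = 1"
    using generic_nonzero[OF assms] by (simp add: power2_eq_square field_simps)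
  then show False using assms by (auto simp: generic_def)
qed

lemma q_int_3:
  assumes "generic q"
  shows "q_int q 3 = q * q + 1 + inverse q * inverse q"
proof -
  have "q powi 3 - q powi (-3) = (q - inverse q) * (q * q + 1 + inverse q * inverse q)"
    using generic_nonzero[OF assms]
    by (simp add: power_int_minus field_simps eval_nat_numeral)
  then show ?thesis
    using generic_diff[OF assms] by (simp add: q_int_def)
qed

lemma q_int_inverse: "q_int (inverse q) n = q_int q n"
  by (simp add: q_int_def power_int_minus power_int_inverse minus_divide_right[symmetric] flip: minus_divide_left)
    (metis minus_diff_eq minus_divide_divide)

context operators
begin

text \<open>
  The second family of tetrahedron relations, multiplied by \<open>q - q\<^sup>-\<^sup>1\<close>.
\<close>

definition q_weyl :: "'k \<Rightarrow> ('v \<Rightarrow> 'v) \<Rightarrow> ('v \<Rightarrow> 'v) \<Rightarrow> bool" where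
  "q_weyl q X Y \<longleftrightarrow>
    (\<forall>v. scale q (X (Y v)) - scale (inverse q) (Y (X v)) = scale (q - inverse q) v)"

definition q_serre :: "'k \<Rightarrow> ('v \<Rightarrow> 'v) \<Rightarrow> ('v \<Rightarrow> 'v) \<Rightarrow> bool" where
  "q_serre q X Z \<longleftrightarrow>
    (\<forall>v. X (X (X (Z v))) - scale (q_int q 3) (X (X (Z (X v))))
       + scale (q_int q 3) (X (Z (X (X v)))) - Z (X (X (X v))) = 0)"

lemma q_weyl_inverse: "q_weyl (inverse q) Y X \<longleftrightarrow> q_weyl q X Y"
proof -
  have "scale (inverse q) a - scale q b = scale (inverse q - q) v \<longleftrightarrow>
      scale q b - scale (inverse q) a = scale (q - inverse q) v" for a b v
    by (metis minus_diff_eq scale_minus_left)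
  then show ?thesis by (simp add: q_weyl_def)
qed

text \<open>
  Applied to an eigenvector \<open>v\<close> of \<open>X\<close>, the relation becomes
  \<open>(X - q\<^sup>-\<^sup>2 t) (Y v) = (1 - q\<^sup>-\<^sup>2) v\<close>, of which \<open>t\<^sup>-\<^sup>1 v\<close> is a particular solution in place of \<open>Y v\<close>.
\<close>

lemma q_weyl_eigen:
  assumes q: "q \<noteq> 0" and XY: "q_weyl q X Y" "lin X" "lin Y"
    and v: "X v = scale t v" "t \<noteq> 0"
  defines "w \<equiv> Y v - scale (inverse t) v"
  shows "X w = scale (t / q ^ 2) w"
proof -
  have "scale q (X (Y v)) = scale (q - inverse q) v + scale (inverse q) (Y (X v))"
    using XY(1) by (simp add: q_weyl_def diff_eq_eq)
  then have "scale (inverse q) (scale q (X (Y v)))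
      = scale (inverse q) (scale (q - inverse q) v + scale (inverse q) (scale t (Y v)))"
    using XY(3) v(1) by (simp add: lin_scale)
  then have "X (Y v) = v - scale (1 / q ^ 2) v + scale (t / q ^ 2) (Y v)"
    using q by (simp add: scale_right_distrib scale_left_diff_distrib scale_right_diff_distrib
        divide_inverse power2_eq_square ac_simps)
  then show ?thesis
    using v XY(2)
    by (simp add: w_def lin_diff lin_scale scale_right_diff_distrib)
qed

text \<open>
  The converse computation, this time at an eigenvector of \<open>Y\<close>.
\<close>

lemma q_weyl_of_eigen:
  assumes q: "q \<noteq> 0" and X: "lin X" and v: "Y v = scale t v" "t \<noteq> 0"
    and w: "Y (X v - scale (inverse t) v) = scale (q ^ 2 * t) (X v - scale (inverse t) v)"
    and Y: "lin Y"
  shows "scale q (X (Y v)) - scale (inverse q) (Y (X v)) = scale (q - inverse q) v"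
proof -
  have "Y (X v) = Y (X v - scale (inverse t) v) + v"
    using v by (simp add: lin_diff[OF Y] lin_scale[OF Y])
  also have "\<dots> = scale (q ^ 2 * t) (X v) - scale (q ^ 2 - 1) v"
    unfolding w using v(2) by (simp add: scale_right_diff_distrib scale_left_diff_distrib)
  finally have YX: "Y (X v) = scale (q ^ 2 * t) (X v) - scale (q ^ 2 - 1) v" .
  have canc: "inverse q * (q * x) = x" for x
    using q by (simp flip: mult.assoc)
  from YX show ?thesis
    using v by (simp add: canc lin_scale[OF X] scale_right_diff_distrib scale_left_diff_distrib
        power2_eq_square mult.assoc)
qed

text \<open>
  Dividing the \<open>n\<close>-th summand of \<open>(A - c m) w\<close> by \<open>c n - c m\<close> gives a vector that differs from \<open>w\<close> by
  an element of the kernel of \<open>A - c m\<close>.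
\<close>

lemma eigenspace_sum_extend:
  assumes A: "lin A" and "finite S" "m \<notin> S" "inj c"
    and w: "A w - scale (c m) w \<in> sum_space (\<lambda>n. eigenspace A (c n)) S"
  shows "w \<in> sum_space (\<lambda>n. eigenspace A (c n)) (insert m S)"
proof -
  let ?V = "\<lambda>n. eigenspace A (c n)"
  obtain f where f: "\<And>n. n \<in> S \<Longrightarrow> A (f n) = scale (c n) (f n)"
    and w_eq: "A w - scale (c m) w = (\<Sum>n\<in>S. f n)"
    using w by (auto simp: sum_space_def eigenspace_def)
  have ne: "c n - c m \<noteq> 0" if "n \<in> S" for n
    using that assms(3,4) by (auto simp: inj_eq)
  define g where "g n = scale (inverse (c n - c m)) (f n)" for n
  have g: "A (g n) = scale (c n) (g n)" if "n \<in> S" for n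
    using f[OF that] by (simp add: g_def lin_scale[OF A] mult.commute)
  define h where "h = w - (\<Sum>n\<in>S. g n)"
  have "(\<Sum>n\<in>S. A (g n) - scale (c m) (g n)) = (\<Sum>n\<in>S. f n)"
  proof (rule sum.cong[OF refl])
    fix n assume n: "n \<in> S"
    have "A (g n) - scale (c m) (g n) = scale (c n - c m) (g n)"
      using g[OF n] by (simp add: scale_left_diff_distrib)
    then show "A (g n) - scale (c m) (g n) = f n"
      using ne[OF n] by (simp add: g_def)
  qed
  then have "A h - scale (c m) h = 0"
    using w_eq by (simp add: h_def lin_diff[OF A] lin_sum[OF A] sum_subtractf scale_right_diff_distrib
        scale_sum_right algebra_simps)
  then have "(\<Sum>n\<in>insert m S. if n = m then h else g n) \<in> sum_space ?V (insert m S)"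
    using g by (intro sum_spaceI) (auto simp: eigenspace_def)
  moreover have "(\<Sum>n\<in>insert m S. if n = m then h else g n) = h + (\<Sum>n\<in>S. g n)"
    using assms(2,3) by simp (rule sum.cong, auto)
  ultimately show ?thesis by (simp add: h_def)
qed

end

context flags
begin

definition weight :: "'k \<Rightarrow> int \<Rightarrow> 'k" where
  "weight q n = q powi (d - 2 * n)"

lemma weight_inverse: "weight (inverse q) n = weight q (d - n)"
  by (simp add: weight_def power_int_inverse flip: power_int_minus)

lemma weight_reverse: "q \<noteq> 0 \<Longrightarrow> weight q (d - n) = inverse (weight q n)"
  by (simp add: weight_def flip: power_int_minus)

lemma weight_nonzero: "q \<noteq> 0 \<Longrightarrow> weight q n \<noteq> 0"
  by (simp add: weight_def)

lemma weight_shift: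
  assumes "q \<noteq> 0"
  shows "weight q (n + 1) = weight q n / q ^ 2" "weight q (n - 1) = q ^ 2 * weight q n"
proof -
  have "d - 2 * (n + 1) = (d - 2 * n) - 2" "d - 2 * (n - 1) = 2 + (d - 2 * n)"
    by simp_all
  then show "weight q (n + 1) = weight q n / q ^ 2" "weight q (n - 1) = q ^ 2 * weight q n"
    using assms by (simp_all add: weight_def power_int_diff power_int_add)
qed

lemma weight_inj: "generic q \<Longrightarrow> inj (weight q)"
  by (rule injI) (use injD[OF generic_inj[of q]] in \<open>fastforce simp: weight_def\<close>)

text \<open>
  The operators of the tetrahedron: if the flag \<open>F\<close> belongs to the vertex \<open>i\<close> and \<open>G\<close> to the vertex \<open>j\<close>,
  then \<open>arrow q F G X\<close> holds for the operator \<open>X\<close> by which \<open>x\<^sub>i\<^sub>j\<close> acts.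
\<close>

abbreviation arrow :: "'k \<Rightarrow> (int \<Rightarrow> 'v set) \<Rightarrow> (int \<Rightarrow> 'v set) \<Rightarrow> ('v \<Rightarrow> 'v) \<Rightarrow> bool" where
  "arrow q \<equiv> edge (weight q)"

lemma arrow_inverse: "arrow q F G X \<Longrightarrow> arrow (inverse q) G F X"
  using edge_sym[of "weight q" F G X] by (simp add: weight_inverse[abs_def])

lemma arrow_acts:
  "arrow q F G X \<Longrightarrow> acts X (weight q) F" "arrow q F G X \<Longrightarrow> acts X (weight (inverse q)) G"
  by (simp_all add: edge_def weight_inverse[abs_def])

lemma arrowI:
  "opposite F G \<Longrightarrow> lin X \<Longrightarrow> acts X (weight q) F \<Longrightarrow> acts X (weight (inverse q)) G \<Longrightarrow> arrow q F G X"
  by (simp add: edge_def weight_inverse[abs_def])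

lemma q_weyl_meet:
  assumes q: "generic q" and X: "arrow q F G X" and Y: "lin Y" and XY: "q_weyl q X Y"
    and v: "v \<in> meet F G n"
  shows "Y v - scale (weight (inverse q) n) v \<in> meet F G (n + 1)"
proof -
  have "X (Y v - scale (inverse (weight q n)) v)
      = scale (weight q n / q ^ 2) (Y v - scale (inverse (weight q n)) v)"
    using generic_nonzero[OF q] edge_eigen[OF X v]
    by (intro q_weyl_eigen[OF _ XY edge_lin[OF X] Y]) (simp_all add: weight_nonzero)
  then have "Y v - scale (inverse (weight q n)) v \<in> eigenspace X (weight q (n + 1))"
    using generic_nonzero[OF q] by (simp add: eigenspace_def weight_shift)
  then show ?thesis
    unfolding edge_eigenspace[OF X weight_inj[OF q]] weight_inverse
      weight_reverse[OF generic_nonzero[OF q]] .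
qed

lemma q_weyl_raises:
  assumes q: "generic q" and X: "arrow q F G X" and Y: "lin Y" and XY: "q_weyl q X Y"
  shows "raises Y F"
  unfolding raises_def
proof (intro allI ballI)
  note opp = edge_opposite[OF X]
  note F = opposite_flags(1)[OF opp]
  fix n v assume "v \<in> F n"
  then have "v \<in> sum_space (meet F G) {0..n}" by (rule flag_sum_space[OF opp])
  then show "Y v \<in> F (n + 1)"
  proof (rule sum_space_image[OF Y flag_subspace[OF F], rotated])
    fix m u assume m: "m \<in> {0..n}" and u: "u \<in> meet F G m"
    let ?w = "Y u - scale (weight (inverse q) m) u"
    have "?w \<in> F (n + 1)" "u \<in> F (n + 1)"
      using q_weyl_meet[OF q X Y XY u] u m
      by (auto simp: meet_def intro: flag_mono[OF F, of "m + 1" "n + 1"] flag_mono[OF F, of m "n + 1"])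
    then have "?w + scale (weight (inverse q) m) u \<in> F (n + 1)"
      by (intro subspace_add subspace_scale flag_subspace F)
    then show "Y u \<in> F (n + 1)" by simp
  qed
qed

text \<open>
  On a summand where \<open>X\<close> has the eigenvalue \<open>t\<close>, the relation forces \<open>Y v = t\<^sup>-\<^sup>1 v\<close> modulo the next
  summand.  On the summand that induces \<open>G n / G (n - 1)\<close>, the inverse of \<open>t\<close> is the weight of \<open>n\<close>.
\<close>

lemma q_weyl_acts:
  assumes q: "generic q" and X: "arrow q F G X" and Y: "lin Y" and XY: "q_weyl q X Y"
  shows "acts Y (weight q) G"
  unfolding acts_def
proof (intro allI ballI)
  note opp = opposite_sym[OF edge_opposite[OF X]]
  note G = opposite_flags(1)[OF opp]
  fix n v assume "v \<in> G n"
  then have "v \<in> sum_space (meet G F) {0..n}" by (rule flag_sum_space[OF opp])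
  then show "Y v - scale (weight q n) v \<in> G (n - 1)"
  proof (rule sum_space_image[OF lin_minus_scale[OF Y] flag_subspace[OF G], rotated])
    fix m u assume m: "m \<in> {0..n}" and u: "u \<in> meet G F m"
    let ?w = "Y u - scale (weight q m) u"
    have "?w \<in> meet F G (d - m + 1)"
      using q_weyl_meet[OF q X Y XY, of u "d - m"] u by (simp add: meet_sym[of G F] weight_inverse)
    then have w: "?w \<in> G (m - 1)" by (simp add: meet_def)
    show "Y u - scale (weight q n) u \<in> G (n - 1)"
    proof (cases "m = n")
      case False
      then have "?w \<in> G (n - 1)" "u \<in> G (n - 1)"
        using w u m flag_mono[OF G, of "m - 1" "n - 1"] flag_mono[OF G, of m "n - 1"]
        by (auto simp: meet_def)
      then have "?w + scale (weight q m - weight q n) u \<in> G (n - 1)"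
        by (intro subspace_add subspace_scale flag_subspace G)
      then show ?thesis by (simp add: scale_left_diff_distrib)
    qed (use w in simp)
  qed
qed

lemma q_weyl_acts_left:
  assumes q: "generic q" and Y: "arrow q G H Y" and X: "lin X" and XY: "q_weyl q X Y"
  shows "acts X (weight (inverse q)) G"
  using q_weyl_acts[OF generic_inverse[OF q] arrow_inverse[OF Y] X] XY by (simp add: q_weyl_inverse)

text \<open>
  On the summand \<open>meet G H n\<close>, the operator \<open>X\<close> minus its scalar on \<open>G n / G (n - 1)\<close> lowers the
  index of \<open>G\<close> and, by the assumption on \<open>H\<close>, raises the index of \<open>H\<close> by at most one.  The result
  therefore lies in the adjacent summand \<open>meet G H (n - 1)\<close>, on which \<open>Y\<close> has the eigenvalue that the
  \<open>q\<close>-Weyl relation requires.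
\<close>

lemma triangle:
  assumes q: "generic q" and X: "arrow q F G X" and Y: "arrow q G H Y" and XH: "raises X H"
  shows "q_weyl q X Y"
  unfolding q_weyl_def
proof
  note q0 = generic_nonzero[OF q]
  note X_lin = edge_lin[OF X] and Y_lin = edge_lin[OF Y]
  have sum: "sum_space (meet G H) {0..d} = UNIV"
    using edge_opposite[OF Y] by (simp add: opposite_def)
  fix v
  show "scale q (X (Y v)) - scale (inverse q) (Y (X v)) = scale (q - inverse q) v"
  proof (rule lin_eqI[of "\<lambda>v. scale q (X (Y v)) - scale (inverse q) (Y (X v))"
          "scale (q - inverse q)" "meet G H" "{0..d}"])
    show "sum_space (meet G H) {0..d} = UNIV" by (rule sum)
    fix n u assume u: "u \<in> meet G H n"
    let ?t = "weight q n"
    let ?w = "X u - scale (inverse ?t) u"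
    have "?w \<in> G (n - 1)"
      using actsD[OF arrow_acts(2)[OF X], of u n "n - 1"] u q0
      by (simp add: meet_def weight_inverse weight_reverse)
    moreover have "?w \<in> H (d - (n - 1))"
    proof (rule subspace_diff[OF _ _ subspace_scale])
      show "subspace (H (d - (n - 1)))"
        by (rule flag_subspace[OF opposite_flags(2)[OF edge_opposite[OF Y]]])
      then show "subspace (H (d - (n - 1)))" .
      show "X u \<in> H (d - (n - 1))"
        using raisesD[OF XH, of u "d - n" "d - (n - 1)"] u by (simp add: meet_def)
      show "u \<in> H (d - (n - 1))"
        using u flag_mono[OF opposite_flags(2)[OF edge_opposite[OF Y]], of "d - n" "d - (n - 1)"]
        by (simp add: meet_def)
    qed
    ultimately have "?w \<in> meet G H (n - 1)" by (simp add: meet_def)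
    then have "Y ?w = scale (q ^ 2 * ?t) ?w"
      using edge_eigen[OF Y, of ?w "n - 1"] q0 by (simp add: weight_shift)
    then show "scale q (X (Y u)) - scale (inverse q) (Y (X u)) = scale (q - inverse q) u"
      using edge_eigen[OF Y u] q0 weight_nonzero[OF q0]
      by (intro q_weyl_of_eigen[OF q0 X_lin _ _ _ Y_lin, of u ?t]) simp_all
  qed (use X_lin Y_lin in \<open>simp_all add: lin_iff scale_right_distrib scale_right_diff_distrib ac_simps\<close>)
qed

lemma triangle_raises:
  assumes "generic q" "arrow q F G X" "arrow q G H Y" "raises X H"
  shows "raises Y F"
  using q_weyl_raises[OF assms(1,2) edge_lin[OF assms(3)]] triangle[OF assms] by simp

lemma arrow_inverse_maps:
  assumes q: "generic q" and X: "arrow q F G X" and Y: "arrow q G F Y"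
  shows "X (Y v) = v"
proof (rule lin_eqI[of "\<lambda>v. X (Y v)" "\<lambda>v. v" "meet F G" "{0..d}"])
  show "lin (\<lambda>v. X (Y v))"
    using edge_lin[OF X] edge_lin[OF Y] by (simp add: lin_iff)
  show "sum_space (meet F G) {0..d} = UNIV"
    using edge_opposite[OF X] by (simp add: opposite_def)
  fix n u assume u: "u \<in> meet F G n"
  then have "Y u = scale (weight q (d - n)) u"
    using edge_eigen[OF Y, of u "d - n"] by (simp add: meet_sym[of G F])
  then show "X (Y u) = u"
    using edge_eigen[OF X u] generic_nonzero[OF q]
    by (simp add: lin_scale[OF edge_lin[OF X]] weight_reverse weight_nonzero)
qed (simp add: lin_id)

end

section \<open>The cubic \<open>q\<close>-Serre relation\<close>

context operators
begin

text \<open>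
  On an eigenvector \<open>u\<close> of \<open>X\<close> the cubic expression is a monic cubic polynomial in \<open>X\<close> applied to
  \<open>Z u\<close>; the assumptions on \<open>a\<close>, \<open>b\<close>, \<open>c\<close> are Vieta's formulas for its roots.
\<close>

lemma cubic_factor:
  assumes X: "lin X" and Z: "lin Z" and u: "X u = scale t u"
    and abc: "a + b + c = k * t" "a * b + b * c + a * c = k * t ^ 2" "a * b * c = t ^ 3"
    and w1: "w1 = X (Z u) - scale a (Z u)" and w2: "w2 = X w1 - scale b w1"
  shows "X w2 - scale c w2
    = X (X (X (Z u))) - scale k (X (X (Z (X u)))) + scale k (X (Z (X (X u)))) - Z (X (X (X u)))"
proof -
  let ?w = "Z u"
  have "X w2 - scale c w2 = X (X (X ?w)) - scale (a + b + c) (X (X ?w))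
      + scale (a * b + b * c + a * c) (X ?w) - scale (a * b * c) ?w"
    by (simp add: w1 w2 lin_diff[OF X] lin_scale[OF X] lin_add[OF X] scale_left_distrib
        scale_right_distrib scale_right_diff_distrib algebra_simps)
  then show ?thesis
    unfolding abc by (simp add: u lin_scale[OF X] lin_scale[OF Z] power2_eq_square power3_eq_cube ac_simps)
qed

end

context flags
begin

text \<open>
  Since \<open>[3]\<^sub>q = q\<^sup>2 + 1 + q\<^sup>-\<^sup>2\<close>, the roots of the cubic polynomial in \<open>cubic_factor\<close> are \<open>q\<^sup>2 t\<close>, \<open>t\<close>
  and \<open>q\<^sup>-\<^sup>2 t\<close>.  If \<open>t\<close> is a weight, these are three consecutive weights.
\<close>

lemma weight_symmetric_functions:
  fixes n
  assumes q: "generic q"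
  defines "a \<equiv> weight q (n + 1)" and "b \<equiv> weight q (n - 1)" and "c \<equiv> weight q n"
  shows "a + b + c = q_int q 3 * c" "a * b + b * c + a * c = q_int q 3 * c ^ 2" "a * b * c = c ^ 3"
  unfolding a_def b_def c_def weight_shift[OF generic_nonzero[OF q]] q_int_3[OF q]
  using generic_nonzero[OF q] by (simp_all add: power2_eq_square power3_eq_cube field_simps)

lemma acts_shift:
  assumes "acts X c F" "is_flag F" "v \<in> F n"
  shows "X v - scale k v \<in> F n"
proof -
  have "X v - scale (c n) v \<in> F n"
    using actsD[OF assms(1,3) refl] flag_mono[OF assms(2), of "n - 1" n] by simp
  then have "(X v - scale (c n) v) + scale (c n - k) v \<in> F n"
    using assms by (intro subspace_add subspace_scale flag_subspace)
  then show ?thesis by (simp add: scale_left_diff_distrib)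
qed

text \<open>
  For \<open>u\<close> in the \<open>n\<close>-th summand, \<open>Z u\<close> lies in \<open>F (n + 1) \<inter> G (d - n + 1)\<close>.  One linear factor of
  the cubic polynomial lowers the index of \<open>F\<close>, the next one that of \<open>G\<close>, and the result lies in the \<open>n\<close>-th
  summand, which the third factor kills.
\<close>

lemma q_serre_of_raises:
  assumes q: "generic q" and X: "arrow q F G X" and Z: "lin Z" "raises Z F" "raises Z G"
  shows "q_serre q X Z"
  unfolding q_serre_def
proof
  note X_lin = edge_lin[OF X]
  note F = opposite_flags(1)[OF edge_opposite[OF X]] and G = opposite_flags(2)[OF edge_opposite[OF X]]
  let ?S = "\<lambda>v. X (X (X (Z v))) - scale (q_int q 3) (X (X (Z (X v))))
       + scale (q_int q 3) (X (Z (X (X v)))) - Z (X (X (X v)))"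
  fix v
  show "?S v = 0"
  proof (rule lin_eqI[of ?S "\<lambda>v. 0" "meet F G" "{0..d}"])
    show "lin ?S"
      using X_lin Z(1) by (simp add: lin_iff scale_right_distrib scale_right_diff_distrib algebra_simps)
    show "lin (\<lambda>v. 0)" by (simp add: lin_iff)
    show "sum_space (meet F G) {0..d} = UNIV"
      using edge_opposite[OF X] by (simp add: opposite_def)
    fix n u assume u: "u \<in> meet F G n"
    define w1 where "w1 = X (Z u) - scale (weight q (n + 1)) (Z u)"
    define w2 where "w2 = X w1 - scale (weight q (n - 1)) w1"
    have "Z u \<in> F (n + 1)"
      using raisesD[OF Z(2)] u by (simp add: meet_def)
    then have w1F: "w1 \<in> F n"
      using actsD[OF arrow_acts(1)[OF X], of "Z u" "n + 1" n] by (simp add: w1_def)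
    have "Z u \<in> G (d - n + 1)"
      using raisesD[OF Z(3)] u by (simp add: meet_def)
    then have w1G: "w1 \<in> G (d - n + 1)"
      unfolding w1_def by (rule acts_shift[OF arrow_acts(2)[OF X] G])
    have "w2 \<in> F n"
      unfolding w2_def by (rule acts_shift[OF arrow_acts(1)[OF X] F w1F])
    moreover have "w2 \<in> G (d - n)"
    proof -
      have "d - (d - n + 1) = n - 1" by simp
      then show ?thesis
        using actsD[OF arrow_acts(2)[OF X] w1G, of "d - n"] by (simp add: w2_def weight_inverse)
    qed
    ultimately have "X w2 = scale (weight q n) w2"
      by (intro edge_eigen[OF X]) (simp add: meet_def)
    then show "?S u = 0"
      using cubic_factor[OF X_lin Z(1) edge_eigen[OF X u] weight_symmetric_functions[OF q] w1_def w2_def]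
      by simp
  qed
qed

lemma arrow_diagonalizable:
  assumes "arrow q F G X"
  shows "diagonalizable scale X"
proof -
  let ?S = "{v. \<exists>t. X v = scale t v}"
  obtain B where B: "B \<subseteq> ?S" "independent B" "?S \<subseteq> span B"
    using maximal_independent_subset by blast
  have "v \<in> span B" for v
  proof -
    obtain f where f: "\<forall>n\<in>{0..d}. f n \<in> meet F G n" and v: "v = (\<Sum>n\<in>{0..d}. f n)"
      using opposite_decompose[OF edge_opposite[OF assms]] by blast
    have "f n \<in> span B" if "n \<in> {0..d}" for n
      using f that edge_eigen[OF assms] B(3) by blast
    then show ?thesis unfolding v by (rule span_sum)
  qed
  then have "span B = UNIV" by blast
  then show ?thesis using B unfolding diagonalizable_def by blast
qed

lemma arrow_eigenvalues:
  assumes X: "arrow q F G X" and "strict F"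
  shows "eigenvalues scale X = weight q ` {0..d}"
proof (intro equalityI subsetI)
  note opp = edge_opposite[OF X]
  fix t
  {
    assume "t \<in> eigenvalues scale X"
    then obtain v where v: "v \<noteq> 0" "X v = scale t v" by (auto simp: eigenvalues_def)
    obtain f where f: "\<forall>n\<in>{0..d}. f n \<in> meet F G n" and v_eq: "v = (\<Sum>n\<in>{0..d}. f n)"
      using opposite_decompose[OF opp] by blast
    have "(\<Sum>n\<in>{0..d}. scale (weight q n - t) (f n)) = (\<Sum>n\<in>{0..d}. X (f n) - scale t (f n))"
      by (rule sum.cong) (simp_all only: edge_eigen[OF X bspec[OF f]] scale_left_diff_distrib)
    also have "\<dots> = X v - scale t v"
      by (simp add: v_eq lin_sum[OF edge_lin[OF X]] scale_sum_right sum_subtractf)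
    finally have sum0: "(\<Sum>n\<in>{0..d}. scale (weight q n - t) (f n)) = 0"
      using v by simp
    have "scale (weight q n - t) (f n) = 0" if "n \<in> {0..d}" for n
      by (rule meet_independent[OF opp _ _ sum0 that])
        (use f subspace_scale[OF subspace_meet[OF opp]] in auto)
    moreover obtain n where "n \<in> {0..d}" "f n \<noteq> 0"
      using v(1) unfolding v_eq by (meson sum.not_neutral_contains_not_neutral)
    ultimately have "n \<in> {0..d}" "weight q n - t = 0"
      by (metis scale_eq_0_iff)+
    then show "t \<in> weight q ` {0..d}" by auto
  next
    assume "t \<in> weight q ` {0..d}"
    then obtain n where n: "n \<in> {0..d}" "t = weight q n" by auto
    then have "meet F G n \<noteq> {0}"
      using assms(2) strict_iff_meet[OF opp] by blast
    then obtain v where "v \<in> meet F G n" "v \<noteq> 0"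
      using subspace_0[OF subspace_meet[OF opp]] by blast
    then show "t \<in> eigenvalues scale X"
      using edge_eigen[OF X] n by (auto simp: eigenvalues_def)
  }
qed

section \<open>The flags of an operator\<close>

text \<open>
  Since \<open>weight (inverse q) m = weight q (d - m)\<close>, taking \<open>inverse q\<close> for \<open>q\<close> adds up the same
  eigenspaces in the reverse order.
\<close>

definition eigenflag :: "'k \<Rightarrow> ('v \<Rightarrow> 'v) \<Rightarrow> int \<Rightarrow> 'v set" where
  "eigenflag q A n = sum_space (\<lambda>m. eigenspace A (weight q m)) {0..n}"

lemma eigenspace_eq_0:
  assumes "lin A" "eigenvalues scale A = weight q ` {0..d}" "generic q" "n \<notin> {0..d}"
  shows "eigenspace A (weight q n) = {0}"
proof -
  have "weight q n \<notin> eigenvalues scale A"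
    using assms weight_inj[OF assms(3)] by (auto simp: inj_eq)
  then show ?thesis
    using lin_0[OF assms(1)] by (auto simp: eigenvalues_def eigenspace_def)
qed

lemma weights_inverse: "weight (inverse q) ` {0..d} = weight q ` {0..d}"
proof -
  have "weight (inverse q) ` {0..d} = weight q ` (\<lambda>n. d - n) ` {0..d}"
    by (simp only: image_image weight_inverse[abs_def])
  moreover have "(\<lambda>n. d - n) ` {0..d} = {0..d}"
    by (simp add: image_diff_atLeastAtMost)
  ultimately show ?thesis by simp
qed

text \<open>
  The cubic polynomial in \<open>A\<close> that annihilates \<open>B v\<close> has distinct roots; its linear factors are
  removed one at a time.
\<close>

lemma q_serre_tridiagonal:
  assumes q: "generic q" and A: "lin A" and B: "lin B" and AB: "q_serre q A B"
    and v: "v \<in> eigenspace A (weight q n)"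
  shows "B v \<in> sum_space (\<lambda>m. eigenspace A (weight q m)) {n - 1, n, n + 1}"
proof -
  let ?V = "\<lambda>m. eigenspace A (weight q m)"
  note ext = eigenspace_sum_extend[OF A _ _ weight_inj[OF q]]
  define w1 where "w1 = A (B v) - scale (weight q (n + 1)) (B v)"
  define w2 where "w2 = A w1 - scale (weight q (n - 1)) w1"
  have "A v = scale (weight q n) v" using v by (simp add: eigenspace_def)
  then have "A w2 - scale (weight q n) w2 = 0"
    using cubic_factor[OF A B _ weight_symmetric_functions[OF q] w1_def w2_def] AB
    unfolding q_serre_def by metis
  then have "A w2 - scale (weight q n) w2 \<in> sum_space ?V {}"
    by (simp add: sum_space_def)
  then have "w2 \<in> sum_space ?V {n}" by (rule ext[rotated 2]) auto
  then have "w1 \<in> sum_space ?V {n - 1, n}" unfolding w2_def by (rule ext[rotated 2]) auto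
  then have "B v \<in> sum_space ?V {n + 1, n - 1, n}" unfolding w1_def by (rule ext[rotated 2]) auto
  then show ?thesis by (simp add: insert_commute)
qed

lemma q_serre_inverse: "q_serre (inverse q) A B = q_serre q A B"
  by (simp add: q_serre_def q_int_inverse)

text \<open>
  The sum of the eigenspaces is nonzero, and it is invariant: \<open>B\<close> maps the \<open>n\<close>-th eigenspace into
  the sum of those with the indices \<open>n - 1\<close>, \<open>n\<close>, \<open>n + 1\<close>, and those with index \<open>-1\<close> or \<open>d + 1\<close> are \<open>0\<close>.
\<close>

lemma eigenspaces_span:
  assumes q: "generic q" and A: "lin A" and B: "lin B" and AB: "q_serre q A B"
    and ev: "eigenvalues scale A = weight q ` {0..d}"
    and irr: "irreducible_pair A B"
  shows "eigenflag q A d = UNIV"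
proof -
  let ?V = "\<lambda>m. eigenspace A (weight q m)"
  let ?W = "sum_space ?V {0..d}"
  note sub = subspace_eigenspace[OF A]
  have W: "subspace ?W"
    using sub by (intro subspace_sum_space)
  have V_W: "?V m \<subseteq> ?W" for m
    using sum_space_incl[of "{0..d}" m ?V] sub eigenspace_eq_0[OF A ev q, of m] subspace_0[OF W]
    by (cases "m \<in> {0..d}") auto
  have "A w \<in> ?W" if "w \<in> ?W" for w
    using that
  proof (rule sum_space_image[OF A W, rotated])
    fix m u assume "u \<in> ?V m"
    then show "A u \<in> ?W"
      using V_W subspace_scale[OF W, of u "weight q m"] by (auto simp: eigenspace_def)
  qed
  moreover have "B w \<in> ?W" if "w \<in> ?W" for w
    using that
  proof (rule sum_space_image[OF B W, rotated])
    fix m u assume "u \<in> ?V m"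
    then show "B u \<in> ?W"
      using q_serre_tridiagonal[OF q A B AB] sum_space_least[OF W, of _ ?V] V_W by blast
  qed
  ultimately have "?W = {0} \<or> ?W = UNIV" using irr W unfolding irreducible_pair_def by blast
  moreover have "weight q 0 \<in> eigenvalues scale A"
    using ev d_nonneg by simp
  then obtain v where "v \<noteq> 0" "v \<in> ?V 0" by (auto simp: eigenvalues_def eigenspace_def)
  then have "?W \<noteq> {0}" using V_W by blast
  ultimately show ?thesis by (simp add: eigenflag_def)
qed

context
  fixes q A
  assumes q: "generic q" and A: "lin A"
    and ev: "eigenvalues scale A = weight q ` {0..d}"
    and span: "eigenflag q A d = UNIV"
begin

lemma eigenspace_eigenflag:
  assumes "m \<le> n"
  shows "eigenspace A (weight q m) \<subseteq> eigenflag q A n"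
proof (cases "0 \<le> m")
  case True
  then show ?thesis
    using assms sum_space_incl[of "{0..n}" m "\<lambda>m. eigenspace A (weight q m)"] subspace_eigenspace[OF A]
    by (simp add: eigenflag_def)
next
  case False
  then show ?thesis
    using eigenspace_eq_0[OF A ev q, of m]
      subspace_0[OF subspace_sum_space[of "{0..n}" "\<lambda>m. eigenspace A (weight q m)"]] subspace_eigenspace[OF A]
    by (simp add: eigenflag_def)
qed

lemma eigenflag_is_flag: "is_flag (eigenflag q A)"
proof -
  have sub: "subspace (eigenflag q A n)" for n
    unfolding eigenflag_def using subspace_eigenspace[OF A] by (intro subspace_sum_space)
  have mono: "eigenflag q A m \<subseteq> eigenflag q A n" if "m \<le> n" for m n
    unfolding eigenflag_def[of q A m]
    using that by (intro sum_space_least[OF sub] eigenspace_eigenflag) auto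
  have "eigenflag q A n = {0}" if "n < 0" for n
    using that by (simp add: eigenflag_def sum_space_def)
  moreover have "eigenflag q A n = UNIV" if "n \<ge> d" for n
    using mono[OF that] span by auto
  ultimately show ?thesis
    using sub mono by (auto simp: is_flag_def)
qed

lemma eigenflag_acts: "acts A (weight q) (eigenflag q A)"
  unfolding acts_def
proof (intro allI ballI)
  fix n v assume "v \<in> eigenflag q A n"
  then show "A v - scale (weight q n) v \<in> eigenflag q A (n - 1)"
    unfolding eigenflag_def[of q A n]
  proof (rule sum_space_image[OF lin_minus_scale[OF A] flag_subspace[OF eigenflag_is_flag], rotated])
    fix m u assume m: "m \<in> {0..n}" and "u \<in> eigenspace A (weight q m)"
    then have u: "A u - scale (weight q n) u = scale (weight q m - weight q n) u"
        and "m \<noteq> n \<Longrightarrow> u \<in> eigenflag q A (n - 1)"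
      using eigenspace_eigenflag[of m "n - 1"] by (auto simp: eigenspace_def scale_left_diff_distrib)
    then show "A u - scale (weight q n) u \<in> eigenflag q A (n - 1)"
      unfolding u using subspace_0[OF flag_subspace[OF eigenflag_is_flag]]
      by (cases "m = n") (auto intro!: subspace_scale[OF flag_subspace[OF eigenflag_is_flag]])
  qed
qed

lemma eigenflag_raises:
  assumes B: "lin B" and AB: "q_serre q A B"
  shows "raises B (eigenflag q A)"
  unfolding raises_def
proof (intro allI ballI)
  fix n v assume "v \<in> eigenflag q A n"
  then show "B v \<in> eigenflag q A (n + 1)"
    unfolding eigenflag_def[of q A n]
  proof (rule sum_space_image[OF B flag_subspace[OF eigenflag_is_flag], rotated])
    fix m u assume m: "m \<in> {0..n}" and u: "u \<in> eigenspace A (weight q m)"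
    have "sum_space (\<lambda>m. eigenspace A (weight q m)) {m - 1, m, m + 1} \<subseteq> eigenflag q A (n + 1)"
      using m by (intro sum_space_least flag_subspace[OF eigenflag_is_flag] eigenspace_eigenflag) auto
    then show "B u \<in> eigenflag q A (n + 1)"
      using q_serre_tridiagonal[OF q A B AB u] by blast
  qed
qed

end

lemma eigenflags_arrow:
  assumes q: "generic q" and A: "lin A"
    and ev: "eigenvalues scale A = weight q ` {0..d}"
    and span: "eigenflag q A d = UNIV" "eigenflag (inverse q) A d = UNIV"
  shows "arrow q (eigenflag q A) (eigenflag (inverse q) A) A" "strict (eigenflag q A)"
proof -
  let ?F = "eigenflag q A" and ?G = "eigenflag (inverse q) A"
  let ?V = "\<lambda>m. eigenspace A (weight q m)"
  have ev': "eigenvalues scale A = weight (inverse q) ` {0..d}"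
    using ev by (simp add: weights_inverse)
  note F = eigenflag_is_flag[OF q A ev span(1)] and G = eigenflag_is_flag[OF generic_inverse[OF q] A ev' span(2)]
  note actF = eigenflag_acts[OF q A ev span(1)] and actG = eigenflag_acts[OF generic_inverse[OF q] A ev' span(2)]
  \<comment> \<open>Both \<open>A - weight q m\<close> and \<open>A - weight q (d - n)\<close> map the intersection into one that vanishes by
      induction, so they vanish on it; but the two weights differ.\<close>
  have disj: "v = 0" if "m + n < d" "v \<in> ?F m" "v \<in> ?G n" for m n v
    using that
  proof (induction "nat (m + n + 1)" arbitrary: m n v rule: less_induct)
    case less
    show ?case
    proof (cases "m < 0 \<or> n < 0")
      case True
      then show ?thesis using less.prems flag_neg[OF F] flag_neg[OF G] by auto
    next
      case False
      have "A v - scale (weight q m) v = 0"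
      proof (rule less.hyps[of "m - 1" n])
        show "A v - scale (weight q m) v \<in> ?F (m - 1)"
          using actsD[OF actF less.prems(2)] by simp
        show "A v - scale (weight q m) v \<in> ?G n"
          by (rule acts_shift[OF actG G less.prems(3)])
      qed (use False less.prems in auto)
      moreover have "A v - scale (weight (inverse q) n) v = 0"
      proof (rule less.hyps[of m "n - 1"])
        show "A v - scale (weight (inverse q) n) v \<in> ?G (n - 1)"
          using actsD[OF actG less.prems(3)] by simp
        show "A v - scale (weight (inverse q) n) v \<in> ?F m"
          by (rule acts_shift[OF actF F less.prems(2)])
      qed (use False less.prems in auto)
      ultimately have "scale (weight q m) v = scale (weight q (d - n)) v"
        by (simp add: weight_inverse)
      moreover have "weight q m \<noteq> weight q (d - n)"
        using weight_inj[OF q] less.prems(1) by (auto simp: inj_eq)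
      ultimately show "v = 0" by simp
    qed
  qed
  have V: "?V n \<subseteq> meet ?F ?G n" for n
    using eigenspace_eigenflag[OF q A ev span(1), of n n]
      eigenspace_eigenflag[OF generic_inverse[OF q] A ev' span(2), of "d - n" "d - n"]
    by (auto simp: meet_def weight_inverse)
  have sub: "subspace (meet ?F ?G n)" for n
    by (simp add: meet_def subspace_inter flag_subspace F G)
  have "sum_space ?V {0..d} \<subseteq> sum_space (meet ?F ?G) {0..d}"
  proof (rule sum_space_least)
    show "subspace (sum_space (meet ?F ?G) {0..d})"
      using sub by (rule subspace_sum_space)
    fix m assume "m \<in> {0..d}"
    then show "?V m \<subseteq> sum_space (meet ?F ?G) {0..d}"
      using V sum_space_incl[of "{0..d}" m "meet ?F ?G"] sub by blast
  qed
  then have "sum_space (meet ?F ?G) {0..d} = UNIV"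
    using span(1) by (auto simp: eigenflag_def)
  moreover have "?F m \<inter> ?G n = {0}" if "m + n < d" for m n
    using disj[OF that] subspace_0[OF flag_subspace[OF F]] subspace_0[OF flag_subspace[OF G]] by blast
  ultimately have opp: "opposite ?F ?G"
    using F G unfolding opposite_def by blast
  then show "arrow q ?F ?G A"
    using A actF actG by (intro arrowI)
  have "meet ?F ?G n \<noteq> {0}" if n: "n \<in> {0..d}" for n
  proof -
    have "weight q n \<in> eigenvalues scale A" using ev n by auto
    then obtain v where "v \<noteq> 0" "v \<in> ?V n" by (auto simp: eigenvalues_def eigenspace_def)
    then show ?thesis using V by blast
  qed
  then show "strict ?F"
    unfolding strict_iff_meet[OF opp] by blast
qed

end

section \<open>The defining relations as conditions on operators\<close>

lemma four_cases: "i = 0 \<or> i = 1 \<or> i = 2 \<or> i = (3::4)"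
proof (cases i)
  case (of_int z)
  then have "z = 0 \<or> z = 1 \<or> z = 2 \<or> z = 3" by auto
  then show ?thesis using of_int by auto
qed

text \<open>
  Sums of vertices produce these numerals, which have to be brought back to \<open>0\<close>, \<open>1\<close>, \<open>2\<close>, \<open>3\<close>.
\<close>

lemma four_reduce: "(4::4) = 0" "(5::4) = 1" "(6::4) = 2"
  by simp_all

lemma tet_generators_opposite: "j - i = 2 \<Longrightarrow> i - j = (2::4)"
  using minus_diff_eq[of j i] by simp

lemma tet_relators_closed:
  "tet_relators q \<subseteq> carrier (free_algebra tet_generators :: ('k::field, (4 \<times> 4, 'k) ncpoly) module)"
  unfolding tet_relators_def Let_def
  by (auto intro!: free_algebra_closed simp: tet_generators_def tet_generators_opposite)

lemma aq_relators_closed: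
  "aq_relators q \<subseteq> carrier (free_algebra UNIV :: ('k::field, (aq_letter, 'k) ncpoly) module)"
  by (auto simp: free_algebra_def)

context operators
begin

definition tet_relations :: "'k \<Rightarrow> (4 \<Rightarrow> 4 \<Rightarrow> 'v \<Rightarrow> 'v) \<Rightarrow> bool" where
  "tet_relations q X \<longleftrightarrow>
    (\<forall>i j. j - i = 2 \<longrightarrow> (\<forall>v. X i j (X j i v) = v)) \<and>
    (\<forall>h i j. (i - h, j - i) \<in> {(1, 1), (1, 2), (2, 1)} \<longrightarrow> q_weyl q (X h i) (X i j)) \<and>
    (\<forall>h i j k. i - h = 1 \<and> j - i = 1 \<and> k - j = 1 \<longrightarrow> q_serre q (X h i) (X j k))"

lemma evaluate_aq_relators:
  assumes "\<And>x. lin (g x)"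
  shows "(\<forall>r\<in>aq_relators q. \<forall>v. evaluate scale g r v = 0) \<longleftrightarrow>
    q_serre q (g LetterX) (g LetterY) \<and> q_serre q (g LetterY) (g LetterX)"
  using assms
  by (simp add: aq_relators_def Let_def evaluate_simps q_serre_def eval_nat_numeral lin_scale)

text \<open>
  The relator contains the relation divided by \<open>q - q\<^sup>-\<^sup>1\<close>, which is invertible for generic \<open>q\<close>.
\<close>

lemma q_weyl_divided:
  assumes "generic q"
  shows "(\<forall>v. scale (1 / (q - inverse q)) (scale q (X (Y v)) - scale (inverse q) (Y (X v))) - v = 0)
    \<longleftrightarrow> q_weyl q X Y"
proof -
  let ?c = "q - inverse q"
  have "scale (1 / ?c) a - v = 0 \<longleftrightarrow> a = scale ?c v" for a v
  proof -
    have "scale (1 / ?c) a - v = 0 \<longleftrightarrow> scale ?c (scale (1 / ?c) a) = scale ?c v"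
      using generic_diff[OF assms] by (simp only: right_minus_eq scale_cancel_left) simp
    then show ?thesis using generic_diff[OF assms] by simp
  qed
  then show ?thesis by (simp add: q_weyl_def)
qed

lemma evaluate_tet_relators:
  assumes q: "generic q" and g: "\<And>x. lin (g x)"
  shows "(\<forall>r\<in>tet_relators q. \<forall>v. evaluate scale g r v = 0) \<longleftrightarrow> tet_relations q (\<lambda>i j. g (i, j))"
proof -
  let ?x = "\<lambda>i j. letter (i, j) :: (4 \<times> 4, 'k) ncpoly"
  let ?e = "\<lambda>r. \<forall>v. evaluate scale g r v = 0"
  have inv: "?e (?x i j * ?x j i - 1) \<longleftrightarrow> (\<forall>v. g (i, j) (g (j, i) v) = v)" for i j
    by (simp add: evaluate_simps g)
  have weyl: "?e (const (1 / (q - inverse q))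
      * (const q * ?x h i * ?x i j - const (inverse q) * ?x i j * ?x h i) - 1)
    \<longleftrightarrow> q_weyl q (g (h, i)) (g (i, j))" for h i j
    unfolding q_weyl_divided[OF q, symmetric] by (simp only: evaluate_simps g)
  have serre: "?e (?x h i ^ 3 * ?x j k - const (q_int q 3) * ?x h i ^ 2 * ?x j k * ?x h i
      + const (q_int q 3) * ?x h i * ?x j k * ?x h i ^ 2 - ?x j k * ?x h i ^ 3)
    \<longleftrightarrow> q_serre q (g (h, i)) (g (j, k))" for h i j k
    by (simp add: evaluate_simps g q_serre_def eval_nat_numeral)
  show ?thesis
    unfolding tet_relators_def Let_def tet_relations_def inv[symmetric] weyl[symmetric] serre[symmetric]
    by blast
qed

end

section \<open>The tetrahedron of flags\<close>

context flags
begin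

context
  fixes q :: 'k and E :: "4 \<Rightarrow> int \<Rightarrow> 'v set" and A B :: "'v \<Rightarrow> 'v"
  assumes q: "generic q" and opp: "\<And>i j. i \<noteq> j \<Longrightarrow> opposite (E i) (E j)"
    and A: "arrow q (E 0) (E 1) A" and B: "arrow q (E 2) (E 3) B"
begin

text \<open>
  The triangles \<open>0 1 2\<close> and \<open>0 1 3\<close> start from the side \<open>A\<close>, the triangles \<open>2 3 0\<close> and \<open>2 3 1\<close> from the
  side \<open>B\<close>.  Together they account for all twelve \<open>q\<close>-Weyl relations.
\<close>

lemma tetrahedron_exists:
  assumes A_raises: "raises A (E 2)" "raises A (E 3)"
    and B_raises: "raises B (E 0)" "raises B (E 1)"
  shows "\<exists>X. (\<forall>i j. i \<noteq> j \<longrightarrow> arrow q (E i) (E j) (X i j)) \<and> X 0 1 = A \<and> X 2 3 = B \<and> tet_relations q X"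
proof -
  have "\<exists>Y. i \<noteq> j \<longrightarrow> arrow q (E i) (E j) Y" for i j
    using edge_exists[OF opp, of i j] by blast
  then obtain X where X: "\<And>i j. i \<noteq> j \<Longrightarrow> arrow q (E i) (E j) (X i j)" by metis
  have XA: "X 0 1 = A" and XB: "X 2 3 = B"
    using edge_unique[OF X A] edge_unique[OF X B] by simp_all
  have tri: "q_weyl q (X h i) (X i j)" "raises (X i j) (E h)"
    if "h \<noteq> i" "i \<noteq> j" "raises (X h i) (E j)" for h i j
    using triangle[OF q X X that(3)] triangle_raises[OF q X X that(3)] that(1,2) by blast+
  note A_raises = A_raises[folded XA] and B_raises = B_raises[folded XB]
  \<comment> \<open>The second sides of the four triangles, and then the third ones.\<close>
  have r: "raises (X 1 2) (E 0)" "raises (X 1 3) (E 0)" "raises (X 3 0) (E 2)" "raises (X 3 1) (E 2)"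
    by (rule tri(2), simp, simp, fact)+
  have r': "raises (X 2 0) (E 1)" "raises (X 3 0) (E 1)" "raises (X 0 2) (E 3)" "raises (X 1 2) (E 3)"
    by (rule tri(2), simp, simp, fact)+
  have weyl: "q_weyl q (X 0 1) (X 1 2)" "q_weyl q (X 0 1) (X 1 3)" "q_weyl q (X 2 3) (X 3 0)"
      "q_weyl q (X 2 3) (X 3 1)" "q_weyl q (X 1 2) (X 2 0)" "q_weyl q (X 1 3) (X 3 0)"
      "q_weyl q (X 3 0) (X 0 2)" "q_weyl q (X 3 1) (X 1 2)" "q_weyl q (X 2 0) (X 0 1)"
      "q_weyl q (X 3 0) (X 0 1)" "q_weyl q (X 0 2) (X 2 3)" "q_weyl q (X 1 2) (X 2 3)"
    by (rule tri(1), simp, simp, fact)+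
  have serre: "q_serre q (X 0 1) (X 2 3)" "q_serre q (X 2 3) (X 0 1)"
      "q_serre q (X 1 2) (X 3 0)" "q_serre q (X 3 0) (X 1 2)"
    by (rule q_serre_of_raises[OF q X edge_lin[OF X]], simp, simp, fact, fact)+
  have "tet_relations q X"
    unfolding tet_relations_def
  proof (intro conjI allI impI)
    fix i j :: 4 and v
    assume "j - i = 2"
    then have "i \<noteq> j" by auto
    then show "X i j (X j i v) = v"
      using arrow_inverse_maps[OF q X X] by simp
  next
    fix h i j :: 4
    assume "(i - h, j - i) \<in> {(1, 1), (1, 2), (2, 1)}"
    then have "(i = h + 1 \<and> j = h + 2) \<or> (i = h + 1 \<and> j = h + 3) \<or> (i = h + 2 \<and> j = h + 3)"
      by (auto simp: diff_eq_eq add.commute)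
    then show "q_weyl q (X h i) (X i j)"
      using four_cases[of h] weyl by (auto simp: four_reduce)
  next
    fix h i j k :: 4
    assume "i - h = 1 \<and> j - i = 1 \<and> k - j = 1"
    then have "i = h + 1 \<and> j = h + 2 \<and> k = h + 3"
      by (auto simp: diff_eq_eq add.commute)
    then show "q_serre q (X h i) (X j k)"
      using four_cases[of h] serre by (auto simp: four_reduce)
  qed
  with X XA XB show ?thesis by blast
qed

text \<open>
  The generators are identified in an order in which each one stands in a \<open>q\<close>-Weyl relation with two
  operators that are already known, one of them on its left, which determines the action on its first
  flag, and one on its right, which determines the action on its second flag.
\<close>

lemma tetrahedron_arrows:
  assumes X: "\<And>i j. (i, j) \<in> tet_generators \<Longrightarrow> lin (X i j)" "X 0 1 = A" "X 2 3 = B"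
    and rel: "tet_relations q X"
    and ij: "(i, j) \<in> tet_generators"
  shows "arrow q (E i) (E j) (X i j)"
proof -
  have weyl: "q_weyl q (X h i) (X i j)" if "(i - h, j - i) \<in> {(1, 1), (1, 2), (2, 1)}" for h i j
    using rel that unfolding tet_relations_def by blast
  have lin: "lin (X i j)" if "j - i = 1 \<or> j - i = 2" for i j
    using X(1) that by (simp add: tet_generators_def)
  note A' = A[folded X(2)] and B' = B[folded X(3)]
  have intro: "arrow q (E i) (E j) (X i j)"
    if "j - i = 1 \<or> j - i = 2" "i \<noteq> j" and F: "arrow q F (E i) Y" "q_weyl q Y (X i j)"
      and G: "arrow q (E j) G Z" "q_weyl q (X i j) Z" for i j F G Y Z
    using arrowI[OF opp[OF that(2)] lin[OF that(1)] q_weyl_acts[OF q F(1) lin[OF that(1)] F(2)]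
        q_weyl_acts_left[OF q G(1) lin[OF that(1)] G(2)]] .
  have 12: "arrow q (E 1) (E 2) (X 1 2)"
    by (rule intro[OF _ _ A' weyl B' weyl]) simp_all
  have 30: "arrow q (E 3) (E 0) (X 3 0)"
    by (rule intro[OF _ _ B' weyl A' weyl]) simp_all
  have 20: "arrow q (E 2) (E 0) (X 2 0)"
    by (rule intro[OF _ _ 12 weyl A' weyl]) simp_all
  have 02: "arrow q (E 0) (E 2) (X 0 2)"
    by (rule intro[OF _ _ 30 weyl B' weyl]) simp_all
  have 13: "arrow q (E 1) (E 3) (X 1 3)"
    by (rule intro[OF _ _ A' weyl 30 weyl]) simp_all
  have 31: "arrow q (E 3) (E 1) (X 3 1)"
    by (rule intro[OF _ _ B' weyl 12 weyl]) simp_all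
  have "j = i + 1 \<or> j = i + 2"
    using ij by (auto simp: tet_generators_def diff_eq_eq add.commute)
  then show ?thesis
    using four_cases[of i] A' B' 12 30 20 02 13 31 by (auto simp: four_reduce)
qed

end

end

section \<open>Extending the action of \<open>\<A>\<^sub>q\<close> to the tetrahedron algebra\<close>

theorem theorem10p4:
  fixes q :: "'k::alg_closed_field"
    and scale :: "'k \<Rightarrow> 'v::ab_group_add \<Rightarrow> 'v"
    and \<rho> :: "(aq_letter, 'k) ncpoly set \<Rightarrow> 'v \<Rightarrow> 'v"
  assumes "q \<noteq> 0" and "\<And>n::nat. n > 0 \<Longrightarrow> q ^ n \<noteq> 1"
    and "vector_space scale" and "finite_dimensional scale"
    and "\<rho> \<in> module_structures (aq_algebra q) scale"
    and "irreducible_module (aq_algebra q) scale \<rho>"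
    and "NonNil q \<rho>"
    and "aq_type q scale \<rho> 1 1"
  shows "(\<exists>!\<sigma>. \<sigma> \<in> module_structures (tet_algebra q) scale \<and>
               \<sigma> (tet_gen q 0 1) = \<rho> (aq_x q) \<and> \<sigma> (tet_gen q 2 3) = \<rho> (aq_y q)) \<and>
         (\<forall>\<sigma>. \<sigma> \<in> module_structures (tet_algebra q) scale \<and>
               \<sigma> (tet_gen q 0 1) = \<rho> (aq_x q) \<and> \<sigma> (tet_gen q 2 3) = \<rho> (aq_y q) \<longrightarrow>
             irreducible_module (tet_algebra q) scale \<sigma> \<and> tet_type q scale \<sigma> 1)"
proof -
  have q: "generic q" using assms(1,2) by (simp add: generic_def)
  interpret operators scale using assms(3) by (simp add: operators_def)
  interpret aq: presentation scale UNIV "aq_relators q"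
    by unfold_locales (rule aq_relators_closed)
  interpret tet: presentation scale tet_generators "tet_relators q"
    by unfold_locales (rule tet_relators_closed)
  define A where "A = \<rho> (aq_x q)"
  define B where "B = \<rho> (aq_y q)"
  have \<rho>: "\<rho> \<in> module_structures aq.P scale"
    using assms(5) by (simp add: aq_algebra_def)
  have images: "aq.images \<rho> LetterX = A" "aq.images \<rho> LetterY = B"
    by (simp_all add: aq.images_def A_def B_def aq_x_def aq_y_def)
  have AB_lin: "lin A" "lin B"
    using aq.images_lin[OF \<rho>, of LetterX] aq.images_lin[OF \<rho>, of LetterY] by (simp_all add: images)
  have serre: "q_serre q A B" "q_serre q B A"
    using evaluate_aq_relators[of "aq.images \<rho>" q] aq.images_lin[OF \<rho>] aq.module_structure_relator[OF \<rho>]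
    by (auto simp: images)
  have irr: "irreducible_pair A B"
    unfolding irreducible_pair_def
  proof (intro allI impI, elim conjE)
    fix W assume W: "subspace W" "\<forall>w\<in>W. A w \<in> W \<and> B w \<in> W"
    have gen: "\<rho> (aq.gen x) w \<in> W" if "w \<in> W" for x w
      using bspec[OF W(2) that] by (cases x) (simp_all add: A_def B_def aq_x_def aq_y_def)
    have "\<rho> a w \<in> W" if "a \<in> carrier aq.P" "w \<in> W" for a w
      using aq.invariant_subspace[OF \<rho> W(1) gen that] .
    then show "W = {0} \<or> W = UNIV"
      using assms(6) W(1) unfolding irreducible_module_def aq_algebra_def by blast
  qed
  obtain d :: nat where d: "eigenvalues scale A = {1 * q powi (int d - 2 * int n) | n. n \<le> d}"
      "eigenvalues scale B = {1 * q powi (int d - 2 * int n) | n. n \<le> d}"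
    using assms(8) unfolding aq_type_def A_def B_def by blast
  interpret flags scale "int d" by unfold_locales simp
  have weights: "{1 * q powi (int d - 2 * int n) | n. n \<le> d} = weight q ` {0..int d}"
  proof -
    have "{0..int d} = int ` {0..d}"
      by (simp add: image_int_atLeastAtMost)
    then show ?thesis by (auto simp: weight_def image_image)
  qed
  note ev = d[unfolded weights]
  have ev': "eigenvalues scale A = weight (inverse q) ` {0..int d}"
      "eigenvalues scale B = weight (inverse q) ` {0..int d}"
    using ev by (simp_all add: weights_inverse)
  note q' = generic_inverse[OF q]
  have serre': "q_serre (inverse q) A B" "q_serre (inverse q) B A"
    using serre by (simp_all add: q_serre_inverse)
  note irr' = irreducible_pair_sym[OF irr]
  note span = eigenspaces_span[OF q AB_lin serre(1) ev(1) irr]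
    eigenspaces_span[OF q' AB_lin serre'(1) ev'(1) irr]
    eigenspaces_span[OF q AB_lin(2,1) serre(2) ev(2) irr']
    eigenspaces_span[OF q' AB_lin(2,1) serre'(2) ev'(2) irr']
  define E :: "4 \<Rightarrow> int \<Rightarrow> 'v set" where
    "E = (\<lambda>i. if i = 0 then eigenflag q A else if i = 1 then eigenflag (inverse q) A
      else if i = 2 then eigenflag q B else eigenflag (inverse q) B)"
  have E: "E 0 = eigenflag q A" "E 1 = eigenflag (inverse q) A"
      "E 2 = eigenflag q B" "E 3 = eigenflag (inverse q) B"
    by (simp_all add: E_def)
  have arrow_A: "arrow q (E 0) (E 1) A" and strict0: "strict (E 0)"
    using eigenflags_arrow[OF q AB_lin(1) ev(1) span(1,2)] unfolding E .
  have arrow_B: "arrow q (E 2) (E 3) B" and strict2: "strict (E 2)"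
    using eigenflags_arrow[OF q AB_lin(2) ev(2) span(3,4)] unfolding E .
  have A_raises: "raises A (E 2)" "raises A (E 3)"
    unfolding E
    by (rule eigenflag_raises[OF q AB_lin(2) ev(2) span(3) AB_lin(1) serre(2)]
          eigenflag_raises[OF q' AB_lin(2) ev'(2) span(4) AB_lin(1) serre'(2)])+
  have B_raises: "raises B (E 0)" "raises B (E 1)"
    unfolding E
    by (rule eigenflag_raises[OF q AB_lin(1) ev(1) span(1) AB_lin(2) serre(1)]
          eigenflag_raises[OF q' AB_lin(1) ev'(1) span(2) AB_lin(2) serre'(1)])+
  have opp01: "opposite (E 0) (E 1)" and opp23: "opposite (E 2) (E 3)"
    using edge_opposite[OF arrow_A] edge_opposite[OF arrow_B] .
  note flags = opposite_flags[OF opp01] opposite_flags[OF opp23]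
  note strict = strict0 strict_opposite[OF opp01 strict0]
  note acts_A = arrow_acts[OF arrow_A] and acts_B = arrow_acts[OF arrow_B]
  have opp_AB: "opposite (E 0) (E 2)" "opposite (E 0) (E 3)" "opposite (E 1) (E 2)" "opposite (E 1) (E 3)"
    by (rule opposite_of_irreducible[OF flags(1) strict(1) flags(3) AB_lin(1) acts_A(1) A_raises(1)
          AB_lin(2) acts_B(1) B_raises(1) irr] opposite_of_irreducible[OF flags(1) strict(1) flags(4)
          AB_lin(1) acts_A(1) A_raises(2) AB_lin(2) acts_B(2) B_raises(1) irr]
        opposite_of_irreducible[OF flags(2) strict(2) flags(3) AB_lin(1) acts_A(2) A_raises(1)
          AB_lin(2) acts_B(1) B_raises(2) irr] opposite_of_irreducible[OF flags(2) strict(2) flags(4)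
          AB_lin(1) acts_A(2) A_raises(2) AB_lin(2) acts_B(2) B_raises(2) irr]; assumption)+
  have opp: "opposite (E i) (E j)" if "i \<noteq> j" for i j
    using that four_cases[of i] four_cases[of j] opp01 opp23 opp_AB
      opposite_sym[OF opp01] opposite_sym[OF opp23] opp_AB[THEN opposite_sym]
    by (elim disjE) simp_all
  have E_strict: "strict (E i)" for i
    using strict_opposite[OF opp strict0] strict0 by (cases "i = 0") auto
  have tet_gen: "tet_gen q i j = tet.gen (i, j)" for i j
    by (simp add: tet_gen_def)
  have gens: "(0, 1) \<in> tet_generators" "(2, 3) \<in> tet_generators"
    by (simp_all add: tet_generators_def)
  let ?good = "\<lambda>\<sigma>. \<sigma> \<in> module_structures (tet_algebra q) scale \<and>
               \<sigma> (tet_gen q 0 1) = \<rho> (aq_x q) \<and> \<sigma> (tet_gen q 2 3) = \<rho> (aq_y q)"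
  have good_arrows: "arrow q (E i) (E j) (\<sigma> (tet.gen (i, j)))"
    if good: "?good \<sigma>" and ij: "(i, j) \<in> tet_generators" for \<sigma> i j
  proof -
    have \<sigma>: "\<sigma> \<in> module_structures tet.P scale"
      using good by (simp add: tet_algebra_def)
    have "tet_relations q (\<lambda>i j. tet.images \<sigma> (i, j))"
      using evaluate_tet_relators[OF q, of "tet.images \<sigma>"] tet.images_lin[OF \<sigma>]
        tet.module_structure_relator[OF \<sigma>] by blast
    moreover have "tet.images \<sigma> (0, 1) = A" "tet.images \<sigma> (2, 3) = B"
      using good gens by (simp_all add: tet.images_def A_def B_def tet_gen)
    ultimately have "arrow q (E i) (E j) (tet.images \<sigma> (i, j))"
      using tetrahedron_arrows[OF q opp arrow_A arrow_B, of "\<lambda>i j. tet.images \<sigma> (i, j)" i j]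
        tet.images_lin[OF \<sigma>] ij by blast
    then show ?thesis using ij by (simp add: tet.images_def)
  qed
  have unique: "\<sigma> = \<tau>" if "?good \<sigma>" "?good \<tau>" for \<sigma> \<tau>
  proof (rule tet.module_structure_eqI)
    show "\<sigma> \<in> module_structures tet.P scale" "\<tau> \<in> module_structures tet.P scale"
      using that by (simp_all add: tet_algebra_def)
    fix x :: "4 \<times> 4" assume "x \<in> tet_generators"
    then show "\<sigma> (tet.gen x) = \<tau> (tet.gen x)"
      using edge_unique[OF good_arrows[OF that(1)] good_arrows[OF that(2)]] by (cases x) simp
  qed
  have exists: "\<exists>\<sigma>. ?good \<sigma>"
  proof -
    obtain X where X: "\<And>i j. i \<noteq> j \<Longrightarrow> arrow q (E i) (E j) (X i j)"
      and X01: "X 0 1 = A" and X23: "X 2 3 = B" and rel: "tet_relations q X"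
      using tetrahedron_exists[OF q opp arrow_A arrow_B A_raises B_raises] by blast
    let ?g = "\<lambda>x. X (fst x) (snd x)"
    let ?g' = "\<lambda>x. if x \<in> tet_generators then ?g x else (\<lambda>v. 0)"
    have lin: "lin (?g x)" if "x \<in> tet_generators" for x
    proof -
      have "fst x \<noteq> snd x" using that by (auto simp: tet_generators_def)
      then show ?thesis using edge_lin[OF X] by blast
    qed
    then have lin': "lin (?g' x)" for x
      by (simp add: lin_iff)
    have rel': "tet_relations q (\<lambda>i j. ?g' (i, j))"
      using rel by (auto simp: tet_relations_def tet_generators_def dest: tet_generators_opposite)
    have "\<exists>\<sigma>\<in>module_structures tet.P scale. \<forall>x\<in>tet_generators. \<sigma> (tet.gen x) = ?g x"
    proof (rule tet.module_structure_exists)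
      show "evaluate scale ?g' r v = 0" if "r \<in> tet_relators q" for r v
        using evaluate_tet_relators[OF q, of ?g', OF lin'] rel' that by blast
    qed (rule lin)
    then show ?thesis
      using gens X01 X23 by (auto simp: tet_gen A_def B_def tet_algebra_def)
  qed
  have "irreducible_module (tet_algebra q) scale \<sigma>" if "?good \<sigma>" for \<sigma>
  proof -
    have gen: "tet_gen q 0 1 \<in> carrier (tet_algebra q)" "tet_gen q 2 3 \<in> carrier (tet_algebra q)"
      using tet.gen_closed[OF gens(1)] tet.gen_closed[OF gens(2)] by (simp_all add: tet_gen tet_algebra_def)
    have "W = {0} \<or> W = UNIV"
      if W: "subspace W" and inv: "\<forall>a\<in>carrier (tet_algebra q). \<forall>w\<in>W. \<sigma> a w \<in> W" for W
    proof -
      have "\<forall>w\<in>W. A w \<in> W \<and> B w \<in> W"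
        using inv gen \<open>?good \<sigma>\<close> unfolding A_def B_def by metis
      then show ?thesis using irr W unfolding irreducible_pair_def by blast
    qed
    then show ?thesis
      using assms(6) by (auto simp: irreducible_module_def)
  qed
  moreover have "tet_type q scale \<sigma> 1" if "?good \<sigma>" for \<sigma>
  proof -
    have "diagonalizable scale (\<sigma> (tet_gen q i j)) \<and>
        eigenvalues scale (\<sigma> (tet_gen q i j)) = {1 * q powi (int d - 2 * int n) | n. n \<le> d}"
      if "(i, j) \<in> tet_generators" for i j
      using arrow_diagonalizable[OF good_arrows[OF \<open>?good \<sigma>\<close> that]]
        arrow_eigenvalues[OF good_arrows[OF \<open>?good \<sigma>\<close> that] E_strict]
      unfolding weights tet_gen by simp
    then show ?thesis unfolding tet_type_def by (intro conjI exI[of _ d]) auto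
  qed
  ultimately show ?thesis using exists unique by blast
qed

end
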